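(* Let $H_1,H_2$ be separable Hilbert spaces, let $\gamma_k\in[H_1,H_2]$ ($k\ge 1$) be such that the Hankel operator $\Gamma=\{\gamma_{j+k-1}\}_{j,k\ge 1}$ is bounded from $\ell_2(H_1)$ to $\ell_2(H_2)$, and let $A_{11},A_{12},A_{22}$ be the blocks of $\Gamma^\star\Gamma$ defined in the context. Assume that $$Q_0^2-A_{22}\gg 0,\qquad Q_0^2=\mathrm{diag}\{A_{11},A_{11},\dots\},$$ and that $$A_{11}\ge 0,\qquad A_{22}\ge 0,\qquad A_{12}A_{12}^\star\gg 0 .$$ Then the equation $$q^2=A_{11}+A_{12}(Q^2-A_{22})^{-1}A_{12}^\star,\qquad Q=\mathrm{diag}\{q,q,\dots\},$$ has one and only one strongly positive solution $q^2\in[H_1,H_1]$, and $$\rho_{min}^2=q^2=\underline{q}^2=\overline{q}^2 ,$$ where $\rho_{min}$ is the minimal solution and $\underline{q}^2,\overline{q}^2$ are the strong limits of the even and odd successive approximations, all defined in the context.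
   Context: $[H,K]$ denotes the bounded linear operators from $H$ to $K$. For a Hilbert space $H$, $\ell_2(H)$ is the Hilbert space of sequences $\{\xi_k\}_{k\ge1}$, $\xi_k\in H$, with $\sum_k\|\xi_k\|^2<\infty$. An operator $\rho$ is strongly positive, written $\rho\gg 0$, if $\rho>\delta I$ for some number $\delta>0$. For $q\in[H_1,H_1]$, $\mathrm{diag}\{q,q,\dots\}$ is the block diagonal operator on $\ell_2(H_1)$. Blocks: put $B_r=[\gamma_2,\gamma_3,\dots]$, $B_c=\mathrm{col}[\gamma_2,\gamma_3,\dots]$, $\Gamma_1=\{\gamma_{j+k}\}_{j,k\ge1}$, so that $\Gamma=\begin{bmatrix} \gamma_1 & B_r \\ B_c & \Gamma_1 \end{bmatrix}$ and $\Gamma^\star\Gamma=\begin{bmatrix} A_{11} & A_{12} \\ A_{12}^\star & A_{22} \end{bmatrix}$ with $A_{11}=\gamma_1^\star\gamma_1+B_c^\star B_c\in[H_1,H_1]$, $A_{12}=\gamma_1^\star B_r+B_c^\star\Gamma_1\in[\ell_2(H_1),H_1]$, $A_{22}=\Gamma_1^\star\Gamma_1+B_r^\star B_r\in[\ell_2(H_1),\ell_2(H_1)]$. Minimal solution: a strongly positive operator $\rho_{min}\in[H_1,H_1]$ is called a minimal solution (of the inequality $\Gamma^\star\Gamma\le R^2$, $R=\mathrm{diag}\{\rho,\rho,\dots\}$) if, with $R_{min}=\mathrm{diag}\{\rho_{min},\rho_{min},\dots\}$, one has $R_{min}^2-A_{22}\gg0$ and $\rho_{min}^2=A_{11}+A_{12}(R_{min}^2-A_{22})^{-1}A_{12}^\star$.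 Successive approximations: $q_0^2=A_{11}$ and $q_{n+1}^2=A_{11}+A_{12}(Q_n^2-A_{22})^{-1}A_{12}^\star$, where $Q_n=\mathrm{diag}\{q_n,q_n,\dots\}$, $n\ge0$. When $Q_0^2-A_{22}\gg0$, one has $q_n^2\ge q_0^2$ for all $n$, the sequence $q_0^2,q_2^2,q_4^2,\dots$ is monotonically increasing with strong limit denoted $\underline{q}^2$, and the sequence $q_1^2,q_3^2,q_5^2,\dots$ is monotonically decreasing with strong limit denoted $\overline{q}^2$.
   Formalization: A solution is also required to satisfy Q²−A₂₂≫0, as in the definition of minimal solution; with mere invertibility uniqueness fails (scalars γ₁=γ₂=1, other γₖ=0). Γ₁ is taken as {γ_{j+k+1}}, the actual lower right block of Γ. *)

theory Defs
  imports "HOL-Analysis.Analysis"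
begin

text \<open>
  Complex inner product spaces are built on top of \<open>real_inner\<close>: the real inner
  product is the real part of the complex one, so that the norm is \<open>sqrt (cinner x x)\<close> and
  definiteness is inherited. \<open>cinner\<close> is linear in its first argument.
\<close>

class complex_inner = real_inner +
  fixes scaleC :: "complex \<Rightarrow> 'a \<Rightarrow> 'a" (infixr "*\<^sub>C" 75)
    and cinner :: "'a \<Rightarrow> 'a \<Rightarrow> complex"
  assumes scaleC_add_right: "c *\<^sub>C (x + y) = c *\<^sub>C x + c *\<^sub>C y"
    and scaleC_add_left: "(c + d) *\<^sub>C x = c *\<^sub>C x + d *\<^sub>C x"
    and scaleC_scaleC: "c *\<^sub>C d *\<^sub>C x = (c * d) *\<^sub>C x"
    and scaleR_scaleC: "r *\<^sub>R x = complex_of_real r *\<^sub>C x"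
    and cinner_commute: "cinner x y = cnj (cinner y x)"
    and cinner_add_left: "cinner (x + y) z = cinner x z + cinner y z"
    and cinner_scaleC_left: "cinner (c *\<^sub>C x) y = c * cinner x y"
    and inner_cinner: "inner x y = Re (cinner x y)"

class complex_hilbert = complex_inner + banach

lemma norm_scaleC: "norm (c *\<^sub>C x) = cmod c * norm (x :: 'a :: complex_inner)"
proof -
  have im: "Im (cinner x x) = 0"
    using cinner_commute[of x x] by (metis Reals_cnj_iff complex_is_Real_iff)
  have "cinner (c *\<^sub>C x) (c *\<^sub>C x) = c * cnj (c * cinner x x)"
    by (metis cinner_commute cinner_scaleC_left)
  also have "\<dots> = (c * cnj c) * cnj (cinner x x)" by simp
  finally have "Re (cinner (c *\<^sub>C x) (c *\<^sub>C x)) = (cmod c)\<^sup>2 * Re (cinner x x)"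
    by (simp add: complex_norm_square[symmetric] im flip: of_real_power)
  then show ?thesis
    by (simp add: norm_eq_sqrt_inner inner_cinner real_sqrt_mult)
qed

section \<open>Square summable sequences\<close>

typedef (overloaded) 'a ell2 = "{f :: nat \<Rightarrow> 'a::real_inner. summable (\<lambda>k. (norm (f k))\<^sup>2)}"
  morphisms ell2_nth Abs_ell2
  by (rule exI[of _ "\<lambda>_. 0"]) simp

setup_lifting type_definition_ell2

lemma summable_ell2 [simp]: "summable (\<lambda>k. (norm (ell2_nth x k))\<^sup>2)"
  using ell2_nth by blast

lemma ell2_eqI: "(\<And>k. ell2_nth x k = ell2_nth y k) \<Longrightarrow> x = y"
  by (simp add: ell2_nth_inject[symmetric] fun_eq_iff)

lemma ell2_add_closed:
  fixes f g :: "nat \<Rightarrow> 'a::real_inner"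
  assumes "summable (\<lambda>k. (norm (f k))\<^sup>2)" "summable (\<lambda>k. (norm (g k))\<^sup>2)"
  shows "summable (\<lambda>k. (norm (f k + g k))\<^sup>2)"
proof (rule summable_comparison_test')
  show "summable (\<lambda>k. 2 * (norm (f k))\<^sup>2 + 2 * (norm (g k))\<^sup>2)"
    by (intro summable_add summable_mult assms)
  fix n
  have "(norm (f n + g n))\<^sup>2 \<le> (norm (f n) + norm (g n))\<^sup>2"
    by (intro power_mono norm_triangle_ineq norm_ge_zero)
  also have "\<dots> \<le> 2 * (norm (f n))\<^sup>2 + 2 * (norm (g n))\<^sup>2"
    using sum_squares_bound[of "norm (f n)" "norm (g n)"] by (simp add: power2_sum)
  finally show "norm ((norm (f n + g n))\<^sup>2) \<le> 2 * (norm (f n))\<^sup>2 + 2 * (norm (g n))\<^sup>2"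
    by simp
qed

lemma summable_norm_mult:
  fixes f g :: "nat \<Rightarrow> 'a::real_inner"
  assumes "summable (\<lambda>k. (norm (f k))\<^sup>2)" "summable (\<lambda>k. (norm (g k))\<^sup>2)"
  shows "summable (\<lambda>k. norm (f k) * norm (g k))"
proof (rule summable_comparison_test')
  show "summable (\<lambda>k. (norm (f k))\<^sup>2 + (norm (g k))\<^sup>2)"
    by (intro summable_add assms)
  fix n
  have "2 * (norm (f n) * norm (g n)) \<le> (norm (f n))\<^sup>2 + (norm (g n))\<^sup>2"
    using sum_squares_bound[of "norm (f n)" "norm (g n)"] by simp
  moreover have "0 \<le> norm (f n) * norm (g n)" by simp
  ultimately have "norm (f n) * norm (g n) \<le> (norm (f n))\<^sup>2 + (norm (g n))\<^sup>2" by linarith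
  then show "norm (norm (f n) * norm (g n)) \<le> (norm (f n))\<^sup>2 + (norm (g n))\<^sup>2"
    by simp
qed

lemma summable_inner_ell2:
  "summable (\<lambda>k. inner (ell2_nth x k) (ell2_nth y k))"
  by (rule summable_comparison_test'[OF summable_norm_mult[OF summable_ell2[of x] summable_ell2[of y]]])
     (simp add: Cauchy_Schwarz_ineq2)

instantiation ell2 :: (real_inner) real_inner
begin

lift_definition zero_ell2 :: "'a ell2" is "\<lambda>_. 0" by simp
lift_definition plus_ell2 :: "'a ell2 \<Rightarrow> 'a ell2 \<Rightarrow> 'a ell2" is "\<lambda>f g k. f k + g k"
  by (rule ell2_add_closed)
lift_definition uminus_ell2 :: "'a ell2 \<Rightarrow> 'a ell2" is "\<lambda>f k. - f k" by simp
lift_definition minus_ell2 :: "'a ell2 \<Rightarrow> 'a ell2 \<Rightarrow> 'a ell2" is "\<lambda>f g k. f k - g k"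
  by (simp only: diff_conv_add_uminus) (rule ell2_add_closed; simp)
lift_definition scaleR_ell2 :: "real \<Rightarrow> 'a ell2 \<Rightarrow> 'a ell2" is "\<lambda>r f k. r *\<^sub>R f k"
  by (simp add: power_mult_distrib summable_mult)

definition inner_ell2 :: "'a ell2 \<Rightarrow> 'a ell2 \<Rightarrow> real" where
  "inner_ell2 x y = (\<Sum>k. inner (ell2_nth x k) (ell2_nth y k))"
definition norm_ell2 :: "'a ell2 \<Rightarrow> real" where
  "norm_ell2 x = sqrt (inner x x)"
definition sgn_ell2 :: "'a ell2 \<Rightarrow> 'a ell2" where
  "sgn_ell2 x = inverse (norm x) *\<^sub>R x"
definition dist_ell2 :: "'a ell2 \<Rightarrow> 'a ell2 \<Rightarrow> real" where
  "dist_ell2 x y = norm (x - y)"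
definition uniformity_ell2 :: "('a ell2 \<times> 'a ell2) filter" where
  "uniformity_ell2 = (INF e\<in>{0<..}. principal {(x, y). dist x y < e})"
definition open_ell2 :: "'a ell2 set \<Rightarrow> bool" where
  "open_ell2 U \<longleftrightarrow> (\<forall>x\<in>U. \<forall>\<^sub>F (x', y) in uniformity. x' = x \<longrightarrow> y \<in> U)"

instance
proof
  fix x y z :: "'a ell2" and a b :: real
  show "x + y + z = x + (y + z)" by transfer (simp add: add.assoc)
  show "x + y = y + x" by transfer (simp add: add.commute)
  show "0 + x = x" by transfer simp
  show "- x + x = 0" by transfer simp
  show "x - y = x + - y" by transfer simp
  show "a *\<^sub>R (x + y) = a *\<^sub>R x + a *\<^sub>R y" by transfer (simp add: scaleR_add_right)
  show "(a + b) *\<^sub>R x = a *\<^sub>R x + b *\<^sub>R x" by transfer (simp add: scaleR_add_left)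
  show "a *\<^sub>R b *\<^sub>R x = (a * b) *\<^sub>R x" by transfer simp
  show "1 *\<^sub>R x = x" by transfer simp
  show "inner x y = inner y x" by (simp add: inner_ell2_def inner_commute)
  show "inner (x + y) z = inner x z + inner y z"
    by (simp add: inner_ell2_def plus_ell2.rep_eq inner_add_left suminf_add summable_inner_ell2)
  show "inner (a *\<^sub>R x) y = a * inner x y"
    by (simp add: inner_ell2_def scaleR_ell2.rep_eq suminf_mult summable_inner_ell2)
  show "0 \<le> inner x x"
    by (simp add: inner_ell2_def suminf_nonneg summable_inner_ell2)
  show "inner x x = 0 \<longleftrightarrow> x = 0"
    by (simp add: inner_ell2_def suminf_eq_zero_iff summable_inner_ell2
        ell2_nth_inject[symmetric] zero_ell2.rep_eq fun_eq_iff)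
qed (simp_all only: norm_ell2_def sgn_ell2_def dist_ell2_def uniformity_ell2_def open_ell2_def)

end

lemma norm_ell2_sq: "(norm x)\<^sup>2 = (\<Sum>k. (norm (ell2_nth x k))\<^sup>2)"
  by (simp add: power2_norm_eq_inner inner_ell2_def)

lemma summable_cinner_ell2:
  fixes x y :: "'a::complex_inner ell2"
  shows "summable (\<lambda>k. cinner (ell2_nth x k) (ell2_nth y k))"
proof -
  have cs: "cmod (cinner u v) \<le> 2 * (norm u * norm v)" for u v :: 'a
  proof -
    have "Im (cinner u v) = - inner (\<i> *\<^sub>C u) v"
      by (simp add: inner_cinner cinner_scaleC_left)
    then have "\<bar>Im (cinner u v)\<bar> \<le> norm u * norm v"
      using Cauchy_Schwarz_ineq2[of "\<i> *\<^sub>C u" v] by (simp add: norm_scaleC)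
    moreover have "\<bar>Re (cinner u v)\<bar> \<le> norm u * norm v"
      using Cauchy_Schwarz_ineq2[of u v] by (simp add: inner_cinner)
    ultimately show ?thesis using cmod_le[of "cinner u v"] by linarith
  qed
  show ?thesis
    by (rule summable_comparison_test'[OF summable_mult[OF summable_norm_mult[OF summable_ell2[of x] summable_ell2[of y]], of 2]])
       (rule cs)
qed

instantiation ell2 :: (complex_inner) complex_inner
begin

lift_definition scaleC_ell2 :: "complex \<Rightarrow> 'a ell2 \<Rightarrow> 'a ell2" is "\<lambda>c f k. c *\<^sub>C f k"
  by (simp add: norm_scaleC power_mult_distrib summable_mult)

definition cinner_ell2 :: "'a ell2 \<Rightarrow> 'a ell2 \<Rightarrow> complex" where
  "cinner_ell2 x y = (\<Sum>k. cinner (ell2_nth x k) (ell2_nth y k))"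

instance
proof
  fix x y z :: "'a ell2" and c d :: complex and r :: real
  show "c *\<^sub>C (x + y) = c *\<^sub>C x + c *\<^sub>C y" by transfer (simp add: scaleC_add_right)
  show "(c + d) *\<^sub>C x = c *\<^sub>C x + d *\<^sub>C x" by transfer (simp add: scaleC_add_left)
  show "c *\<^sub>C d *\<^sub>C x = (c * d) *\<^sub>C x" by transfer (simp add: scaleC_scaleC)
  show "r *\<^sub>R x = complex_of_real r *\<^sub>C x" by transfer (simp add: scaleR_scaleC)
  show "cinner x y = cnj (cinner y x)"
  proof -
    have "(\<lambda>k. cnj (cinner (ell2_nth y k) (ell2_nth x k))) sums cnj (cinner y x)"
      unfolding sums_cnj cinner_ell2_def by (rule summable_sums[OF summable_cinner_ell2])
    then show ?thesis
      unfolding cinner_ell2_def[of x y] by (subst cinner_commute) (simp add: sums_iff)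
  qed
  show "cinner (x + y) z = cinner x z + cinner y z"
    by (simp add: cinner_ell2_def plus_ell2.rep_eq cinner_add_left suminf_add summable_cinner_ell2)
  show "cinner (c *\<^sub>C x) y = c * cinner x y"
    by (simp add: cinner_ell2_def scaleC_ell2.rep_eq cinner_scaleC_left suminf_mult summable_cinner_ell2)
  show "inner x y = Re (cinner x y)"
    by (simp add: inner_ell2_def cinner_ell2_def inner_cinner Re_suminf summable_cinner_ell2)
qed

end

lemma norm_ell2_nth_le: "norm (ell2_nth x k) \<le> norm x"
proof -
  have "(norm (ell2_nth x k))\<^sup>2 \<le> (\<Sum>k. (norm (ell2_nth x k))\<^sup>2)"
    using sum_le_suminf[of "\<lambda>k. (norm (ell2_nth x k))\<^sup>2" "{k}"] by simp
  then show ?thesis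
    by (metis norm_ell2_sq norm_ge_zero power2_le_imp_le)
qed

lemma sum_le_norm_ell2: "(\<Sum>k<N. (norm (ell2_nth x k))\<^sup>2) \<le> (norm x)\<^sup>2"
  unfolding norm_ell2_sq by (rule sum_le_suminf) auto

lemma ell2_complete:
  fixes X :: "nat \<Rightarrow> 'a::{real_inner,complete_space} ell2"
  assumes X: "Cauchy X"
  shows "convergent X"
proof -
  have "Cauchy (\<lambda>n. ell2_nth (X n) k)" for k
  proof (rule metric_CauchyI)
    fix e :: real assume "e > 0"
    then obtain M where "\<forall>m\<ge>M. \<forall>n\<ge>M. dist (X m) (X n) < e"
      using X metric_CauchyD by blast
    moreover have "dist (ell2_nth (X m) k) (ell2_nth (X n) k) \<le> dist (X m) (X n)" for m n
      using norm_ell2_nth_le[of "X m - X n" k] by (simp add: dist_norm minus_ell2.rep_eq)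
    ultimately show "\<exists>M. \<forall>m\<ge>M. \<forall>n\<ge>M. dist (ell2_nth (X m) k) (ell2_nth (X n) k) < e"
      by (meson le_less_trans)
  qed
  then have "\<forall>k. \<exists>l. (\<lambda>n. ell2_nth (X n) k) \<longlonglongrightarrow> l"
    by (simp add: Cauchy_convergent_iff convergent_def)
  then obtain l where l: "\<And>k. (\<lambda>n. ell2_nth (X n) k) \<longlonglongrightarrow> l k" by metis
  have tail: "(\<Sum>k<N. (norm (ell2_nth (X m) k - l k))\<^sup>2) \<le> e\<^sup>2"
    if M: "\<And>n. n \<ge> M \<Longrightarrow> dist (X m) (X n) < e" for M m N e
  proof (rule tendsto_upperbound)
    show "(\<lambda>n. \<Sum>k<N. (norm (ell2_nth (X m) k - ell2_nth (X n) k))\<^sup>2)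
        \<longlonglongrightarrow> (\<Sum>k<N. (norm (ell2_nth (X m) k - l k))\<^sup>2)"
      by (intro tendsto_intros l)
    show "\<forall>\<^sub>F n in sequentially. (\<Sum>k<N. (norm (ell2_nth (X m) k - ell2_nth (X n) k))\<^sup>2) \<le> e\<^sup>2"
      using eventually_ge_at_top[of M]
    proof eventually_elim
      case (elim n)
      have "(\<Sum>k<N. (norm (ell2_nth (X m - X n) k))\<^sup>2) \<le> (norm (X m - X n))\<^sup>2"
        by (rule sum_le_norm_ell2)
      also have "\<dots> \<le> e\<^sup>2"
        using M[OF elim] by (intro power_mono) (auto simp: dist_norm)
      finally show ?case by (simp add: minus_ell2.rep_eq)
    qed
  qed simp
  have summ: "summable (\<lambda>k. (norm (ell2_nth (X m) k - l k))\<^sup>2)"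
    if M: "\<And>n. n \<ge> M \<Longrightarrow> dist (X m) (X n) < e" for M m e
  proof (rule bounded_imp_summable)
    show "(\<Sum>k\<le>n. (norm (ell2_nth (X m) k - l k))\<^sup>2) \<le> e\<^sup>2" for n
      using tail[OF M, of M "Suc n"] by (simp only: lessThan_Suc_atMost)
  qed simp
  obtain M where M: "\<forall>m\<ge>M. \<forall>n\<ge>M. dist (X m) (X n) < 1"
    using X metric_CauchyD zero_less_one by blast
  have "summable (\<lambda>k. (norm (ell2_nth (X M) k - l k))\<^sup>2)"
    by (rule summ[of M M 1]) (use M in blast)
  then have "summable (\<lambda>k. (norm (- (ell2_nth (X M) k - l k)))\<^sup>2)"
    by (simp only: norm_minus_cancel)
  from ell2_add_closed[OF summable_ell2[of "X M"] this]
  have "summable (\<lambda>k. (norm (l k))\<^sup>2)" by simp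
  then have nth: "ell2_nth (Abs_ell2 l) = l" by (simp add: Abs_ell2_inverse)
  have "X \<longlonglongrightarrow> Abs_ell2 l"
  proof (rule metric_LIMSEQ_I)
    fix e :: real assume e: "e > 0"
    then obtain M where M: "\<forall>m\<ge>M. \<forall>n\<ge>M. dist (X m) (X n) < e / 2"
      using X metric_CauchyD half_gt_zero by blast
    have "dist (X m) (Abs_ell2 l) < e" if "m \<ge> M" for m
    proof -
      have b: "\<And>n. n \<ge> M \<Longrightarrow> dist (X m) (X n) < e / 2" using M that by blast
      have "(norm (X m - Abs_ell2 l))\<^sup>2 = (\<Sum>k. (norm (ell2_nth (X m) k - l k))\<^sup>2)"
        by (simp add: norm_ell2_sq minus_ell2.rep_eq nth)
      also have "\<dots> \<le> (e / 2)\<^sup>2"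
      proof (rule suminf_le_const)
        show "summable (\<lambda>k. (norm (ell2_nth (X m) k - l k))\<^sup>2)"
          by (rule summ[OF b])
        show "(\<Sum>k<n. (norm (ell2_nth (X m) k - l k))\<^sup>2) \<le> (e / 2)\<^sup>2" for n
          by (rule tail[OF b])
      qed
      finally have "norm (X m - Abs_ell2 l) \<le> e / 2"
        by (rule power2_le_imp_le) (use e in simp)
      then show ?thesis using e by (simp add: dist_norm)
    qed
    then show "\<exists>M. \<forall>m\<ge>M. dist (X m) (Abs_ell2 l) < e" by blast
  qed
  then show ?thesis by (auto simp: convergent_def)
qed

instance ell2 :: (complex_hilbert) complex_hilbert
  by standard (rule ell2_complete)

section \<open>Bounded operators\<close>

text \<open>\<open>'a \<Rightarrow>\<^sub>L 'b\<close> consists of real-linear maps; \<open>[H, K]\<close> is the subset \<open>cbounded_ops\<close>.\<close>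

definition cbounded_ops :: "('a::complex_inner \<Rightarrow>\<^sub>L 'b::complex_inner) set" where
  "cbounded_ops = {T :: 'a \<Rightarrow>\<^sub>L 'b. \<forall>c x. T (c *\<^sub>C x) = c *\<^sub>C T x}"

definition cadjoint :: "('a::complex_inner \<Rightarrow>\<^sub>L 'b::complex_inner) \<Rightarrow> 'b \<Rightarrow>\<^sub>L 'a" where
  "cadjoint T = (THE S :: 'b \<Rightarrow>\<^sub>L 'a. \<forall>x y. cinner (T x) y = cinner x (S y))"

definition op_inverse :: "('a::real_normed_vector \<Rightarrow>\<^sub>L 'b::real_normed_vector) \<Rightarrow> 'b \<Rightarrow>\<^sub>L 'a" where
  "op_inverse T = (THE S. S o\<^sub>L T = id_blinfun \<and> T o\<^sub>L S = id_blinfun)"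

definition positive_op :: "('a::complex_inner \<Rightarrow>\<^sub>L 'a) \<Rightarrow> bool" where
  "positive_op T \<longleftrightarrow> (\<forall>x. cinner (T x) x \<in> \<real>\<^sub>\<ge>\<^sub>0)"

text \<open>Whether \<open>T > \<delta> I\<close> is read strictly or not is immaterial, as \<open>\<delta>\<close> may be shrunk.\<close>

definition strongly_positive :: "('a::complex_inner \<Rightarrow>\<^sub>L 'a) \<Rightarrow> bool" where
  "strongly_positive T \<longleftrightarrow> (\<exists>\<delta>>0. positive_op (T - \<delta> *\<^sub>R id_blinfun))"

definition strong_limit :: "(nat \<Rightarrow> 'a::real_normed_vector \<Rightarrow>\<^sub>L 'b::real_normed_vector) \<Rightarrow> ('a \<Rightarrow>\<^sub>L 'b) \<Rightarrow> bool"
  where "strong_limit T S \<longleftrightarrow> (\<forall>x. (\<lambda>n. T n x) \<longlonglongrightarrow> S x)"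

section \<open>Operators given by block rows, columns and matrices\<close>

text \<open>
  Coordinates in \<open>\<ell>\<^sub>2\<close> are numbered from 0, so coordinate \<open>k\<close> below is the coordinate \<open>k + 1\<close> of
  the usual numbering. The operators below are meaningful only if the block row, column or
  matrix defines a bounded operator.
\<close>

definition has_blocks ::
  "('a::real_inner ell2 \<Rightarrow>\<^sub>L 'b::real_inner ell2) \<Rightarrow> (nat \<Rightarrow> nat \<Rightarrow> 'a \<Rightarrow>\<^sub>L 'b) \<Rightarrow> bool" where
  "has_blocks T M \<longleftrightarrow> (\<forall>x j. (\<lambda>k. M j k (ell2_nth x k)) sums ell2_nth (T x) j)"

definition bounded_blocks :: "(nat \<Rightarrow> nat \<Rightarrow> 'a::real_inner \<Rightarrow>\<^sub>L 'b::real_inner) \<Rightarrow> bool" where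
  "bounded_blocks M \<longleftrightarrow> (\<exists>T. has_blocks T M)"

definition block_op ::
  "(nat \<Rightarrow> nat \<Rightarrow> 'a::real_inner \<Rightarrow>\<^sub>L 'b::real_inner) \<Rightarrow> 'a ell2 \<Rightarrow>\<^sub>L 'b ell2" where
  "block_op M = (THE T. has_blocks T M)"

definition row_op :: "(nat \<Rightarrow> 'a::real_inner \<Rightarrow>\<^sub>L 'b::real_normed_vector) \<Rightarrow> 'a ell2 \<Rightarrow>\<^sub>L 'b" where
  "row_op c = (THE T :: 'a ell2 \<Rightarrow>\<^sub>L 'b. \<forall>x. (\<lambda>k. c k (ell2_nth x k)) sums T x)"

definition col_op :: "(nat \<Rightarrow> 'a::real_normed_vector \<Rightarrow>\<^sub>L 'b::real_inner) \<Rightarrow> 'a \<Rightarrow>\<^sub>L 'b ell2" where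
  "col_op c = (THE T :: 'a \<Rightarrow>\<^sub>L 'b ell2. \<forall>h k. ell2_nth (T h) k = c k h)"

definition diag_op :: "('a::real_inner \<Rightarrow>\<^sub>L 'a) \<Rightarrow> 'a ell2 \<Rightarrow>\<^sub>L 'a ell2" where
  "diag_op q = block_op (\<lambda>j k. if j = k then q else 0)"

section \<open>The Hankel operator and the blocks of its square\<close>

text \<open>The sequence is \<open>\<gamma> 1, \<gamma> 2, \<dots>\<close>; the value \<open>\<gamma> 0\<close> is never used.\<close>

definition hankel :: "(nat \<Rightarrow> 'a) \<Rightarrow> nat \<Rightarrow> nat \<Rightarrow> 'a" where
  "hankel \<gamma> j k = \<gamma> (j + k + 1)"

definition B_r :: "(nat \<Rightarrow> 'a::real_inner \<Rightarrow>\<^sub>L 'b::real_normed_vector) \<Rightarrow> 'a ell2 \<Rightarrow>\<^sub>L 'b" where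
  "B_r \<gamma> = row_op (\<lambda>k. \<gamma> (k + 2))"

definition B_c :: "(nat \<Rightarrow> 'a::real_normed_vector \<Rightarrow>\<^sub>L 'b::real_inner) \<Rightarrow> 'a \<Rightarrow>\<^sub>L 'b ell2" where
  "B_c \<gamma> = col_op (\<lambda>j. \<gamma> (j + 2))"

text \<open>
  The lower right block of the Hankel matrix, obtained by deleting its first row and column:
  \<open>\<gamma> 3, \<gamma> 4, \<dots>\<close> is its first row. The matrix with first row \<open>\<gamma> 2, \<gamma> 3, \<dots>\<close> would not fit into
  the block decomposition \<open>\<Gamma> = [\<gamma>\<^sub>1, B\<^sub>r; B\<^sub>c, \<Gamma>\<^sub>1]\<close>.
\<close>

definition Gamma_1 ::
  "(nat \<Rightarrow> 'a::real_inner \<Rightarrow>\<^sub>L 'b::real_inner) \<Rightarrow> 'a ell2 \<Rightarrow>\<^sub>L 'b ell2" where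
  "Gamma_1 \<gamma> = block_op (\<lambda>j k. hankel \<gamma> (j + 1) (k + 1))"

definition A11 :: "(nat \<Rightarrow> 'a::complex_inner \<Rightarrow>\<^sub>L 'b::complex_inner) \<Rightarrow> 'a \<Rightarrow>\<^sub>L 'a" where
  "A11 \<gamma> = (cadjoint (\<gamma> 1) o\<^sub>L \<gamma> 1) + (cadjoint (B_c \<gamma>) o\<^sub>L B_c \<gamma>)"

definition A12 :: "(nat \<Rightarrow> 'a::complex_inner \<Rightarrow>\<^sub>L 'b::complex_inner) \<Rightarrow> 'a ell2 \<Rightarrow>\<^sub>L 'a" where
  "A12 \<gamma> = (cadjoint (\<gamma> 1) o\<^sub>L B_r \<gamma>) + (cadjoint (B_c \<gamma>) o\<^sub>L Gamma_1 \<gamma>)"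

definition A22 :: "(nat \<Rightarrow> 'a::complex_inner \<Rightarrow>\<^sub>L 'b::complex_inner) \<Rightarrow> 'a ell2 \<Rightarrow>\<^sub>L 'a ell2" where
  "A22 \<gamma> = (cadjoint (Gamma_1 \<gamma>) o\<^sub>L Gamma_1 \<gamma>) + (cadjoint (B_r \<gamma>) o\<^sub>L B_r \<gamma>)"

section \<open>The operator equation\<close>

text \<open>The right-hand side of the equation, as a function of \<open>Q\<^sup>2\<close>.\<close>

definition rhs ::
  "(nat \<Rightarrow> 'a::complex_inner \<Rightarrow>\<^sub>L 'b::complex_inner) \<Rightarrow> ('a ell2 \<Rightarrow>\<^sub>L 'a ell2) \<Rightarrow> 'a \<Rightarrow>\<^sub>L 'a" where
  "rhs \<gamma> Q2 = A11 \<gamma> + (A12 \<gamma> o\<^sub>L op_inverse (Q2 - A22 \<gamma>) o\<^sub>L cadjoint (A12 \<gamma>))"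

text \<open>
  The unknown of the equation is \<open>P = q\<^sup>2\<close>, and \<open>Q\<^sup>2 = diag {P, P, \<dots>}\<close>. As for minimal
  solutions, \<open>Q\<^sup>2 - A\<^sub>2\<^sub>2\<close> is required to be strongly positive. Mere invertibility would not
  do: for scalars with \<open>\<gamma>\<^sub>1 = \<gamma>\<^sub>2 = 1\<close> and \<open>\<gamma>\<^sub>k = 0\<close> otherwise, the equation reads
  \<open>P = 2 + 1 / (P - 1)\<close> and has two positive solutions.
\<close>

definition solution ::
  "(nat \<Rightarrow> 'a::complex_inner \<Rightarrow>\<^sub>L 'b::complex_inner) \<Rightarrow> ('a \<Rightarrow>\<^sub>L 'a) \<Rightarrow> bool" where
  "solution \<gamma> P \<longleftrightarrow> P \<in> cbounded_ops \<and> strongly_positive P \<and>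
     strongly_positive (diag_op P - A22 \<gamma>) \<and> P = rhs \<gamma> (diag_op P)"

definition minimal_solution ::
  "(nat \<Rightarrow> 'a::complex_inner \<Rightarrow>\<^sub>L 'b::complex_inner) \<Rightarrow> ('a \<Rightarrow>\<^sub>L 'a) \<Rightarrow> bool" where
  "minimal_solution \<gamma> \<rho> \<longleftrightarrow> \<rho> \<in> cbounded_ops \<and> strongly_positive \<rho> \<and>
     strongly_positive ((diag_op \<rho> o\<^sub>L diag_op \<rho>) - A22 \<gamma>) \<and>
     \<rho> o\<^sub>L \<rho> = rhs \<gamma> (diag_op \<rho> o\<^sub>L diag_op \<rho>)"

text \<open>\<open>q_sq \<gamma> n\<close> is \<open>q\<^sub>n\<^sup>2\<close>; accordingly \<open>Q\<^sub>n\<^sup>2\<close> is \<open>diag_op (q_sq \<gamma> n)\<close>.\<close>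

primrec q_sq ::
  "(nat \<Rightarrow> 'a::complex_inner \<Rightarrow>\<^sub>L 'b::complex_inner) \<Rightarrow> nat \<Rightarrow> 'a \<Rightarrow>\<^sub>L 'a" where
  "q_sq \<gamma> 0 = A11 \<gamma>"
| "q_sq \<gamma> (Suc n) = rhs \<gamma> (diag_op (q_sq \<gamma> n))"

end

theory Submission imports Defs begin

text \<open>
  Write \<open>F P\<close> for the right-hand side of the equation at \<open>Q\<^sup>2 = diag {P, P, \<dots>}\<close>, and
  \<open>U\<^sub>n = Q\<^sub>n\<^sup>2 - A\<^sub>2\<^sub>2\<close>. On \<open>P \<ge> A\<^sub>1\<^sub>1\<close> the map \<open>F\<close> reverses the operator order, so every solution lies
  between all even and all odd approximations. Moreover \<open>s U\<^sub>2\<^sub>n\<^sub>+\<^sub>1 \<le> U\<^sub>2\<^sub>n\<close> implies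
  \<open>s' U\<^sub>2\<^sub>n\<^sub>+\<^sub>3 \<le> U\<^sub>2\<^sub>n\<^sub>+\<^sub>2\<close> with \<open>1 - s' = (1 - \<beta>) (1 - s)\<close> whenever \<open>\<beta> U\<^sub>1 \<le> U\<^sub>0\<close>, where \<open>\<beta> > 0\<close> exists
  because \<open>U\<^sub>0\<close> is strongly positive. Hence the gap between even and odd approximations tends
  to 0 geometrically, in norm, and both converge to the one solution. The minimal solution is
  its positive square root.
\<close>

section \<open>Complex-linear operators and the operator order\<close>

text \<open>Two obstacles shape the argument. First, \<open>F\<close> need not be a contraction in
  norm: its available Lipschitz constant, \<open>norm A12\<close> times the norm of the adjoint over
  \<open>\<delta>^2\<close>, may exceed 1. The comparison is therefore multiplicative and made
  between the operators that \<open>F\<close> inverts: \<open>s U \<preceq> U'\<close> becomes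
  \<open>s U'^-1 \<preceq> U^-1\<close> with the same \<open>s\<close>, whatever the size of
  \<open>A12\<close>. The gain in each step comes from the summand \<open>A11\<close>, which
  \<open>F\<close> adds unscaled. Second, monotone sequences of operators have only strong limits,
  through which inversion is awkward to pass. The order gap is instead bounded by multiples of the
  identity, and a selfadjoint operator between \<open>0\<close> and \<open>c I\<close> has norm at
  most \<open>c\<close>. So the limits are norm limits, and norm continuity of \<open>F\<close>
  makes the limit a fixed point.\<close>

lemma cinner_scaleC_right: "cinner x (c *\<^sub>C y) = cnj c * cinner x y"
  by (metis cinner_commute cinner_scaleC_left complex_cnj_mult)

lemma scaleC_imaginary_unit_twice: "\<i> *\<^sub>C \<i> *\<^sub>C x = - (x::'a::complex_inner)"
proof -
  have "\<i> *\<^sub>C \<i> *\<^sub>C x = complex_of_real (-1) *\<^sub>C x" by (simp add: scaleC_scaleC)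
  also have "\<dots> = - x" by (simp only: scaleR_scaleC[symmetric]) simp
  finally show ?thesis .
qed

lemma inner_imaginary_unit: "inner (\<i> *\<^sub>C x) (\<i> *\<^sub>C y) = inner x y"
  by (simp add: inner_cinner cinner_scaleC_left cinner_scaleC_right)

lemma Im_cinner: "Im (cinner x y) = - inner (\<i> *\<^sub>C x) y"
  by (simp add: inner_cinner cinner_scaleC_left)

lemma bounded_linear_scaleC: "bounded_linear (\<lambda>x::'a::complex_inner. c *\<^sub>C x)"
proof (rule bounded_linear_intro)
  show "c *\<^sub>C (r *\<^sub>R x) = r *\<^sub>R c *\<^sub>C x" for r and x :: 'a
    by (simp add: scaleR_scaleC scaleC_scaleC mult.commute)
  show "norm (c *\<^sub>C x) \<le> norm x * cmod c" for x :: 'a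
    by (simp add: norm_scaleC)
qed (rule scaleC_add_right)

lemmas scaleC_minus_right = bounded_linear.linear[OF bounded_linear_scaleC, THEN linear_neg]
  and scaleC_diff_right = bounded_linear.linear[OF bounded_linear_scaleC, THEN linear_diff]
  and scaleC_scaleR_right = bounded_linear.linear[OF bounded_linear_scaleC, THEN linear_scale]

lemma cbounded_opsD: "T \<in> cbounded_ops \<Longrightarrow> T (c *\<^sub>C x) = c *\<^sub>C T x"
  by (simp add: cbounded_ops_def)

lemma cbounded_ops_id: "id_blinfun \<in> cbounded_ops"
  by (simp add: cbounded_ops_def)

lemma cbounded_ops_add: "S \<in> cbounded_ops \<Longrightarrow> T \<in> cbounded_ops \<Longrightarrow> S + T \<in> cbounded_ops"
  by (simp add: cbounded_ops_def blinfun.add_left scaleC_add_right)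

lemma cbounded_ops_diff: "S \<in> cbounded_ops \<Longrightarrow> T \<in> cbounded_ops \<Longrightarrow> S - T \<in> cbounded_ops"
  by (simp add: cbounded_ops_def blinfun.diff_left scaleC_diff_right)

lemma cbounded_ops_scaleR: "T \<in> cbounded_ops \<Longrightarrow> r *\<^sub>R T \<in> cbounded_ops"
  by (simp add: cbounded_ops_def blinfun.scaleR_left scaleC_scaleR_right)

lemma cbounded_ops_compose: "S \<in> cbounded_ops \<Longrightarrow> T \<in> cbounded_ops \<Longrightarrow> S o\<^sub>L T \<in> cbounded_ops"
  by (simp add: cbounded_ops_def)

lemma cbounded_ops_lim:
  assumes "X \<longlonglongrightarrow> L" and "\<And>n. X n \<in> cbounded_ops"
  shows "L \<in> cbounded_ops"
proof -
  have "L (c *\<^sub>C x) = c *\<^sub>C L x" for c x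
  proof (rule LIMSEQ_unique)
    show "(\<lambda>n. X n (c *\<^sub>C x)) \<longlonglongrightarrow> L (c *\<^sub>C x)"
      by (intro blinfun.tendsto assms tendsto_const)
    have "(\<lambda>n. c *\<^sub>C X n x) \<longlonglongrightarrow> c *\<^sub>C L x"
      by (intro bounded_linear.tendsto[OF bounded_linear_scaleC] blinfun.tendsto assms tendsto_const)
    then show "(\<lambda>n. X n (c *\<^sub>C x)) \<longlonglongrightarrow> c *\<^sub>C L x"
      by (simp add: cbounded_opsD[OF assms(2)])
  qed
  then show ?thesis by (simp add: cbounded_ops_def)
qed

text \<open>
  For complex-linear operators, adjoints and positivity with respect to \<open>cinner\<close> can be tested
  with the real inner product.
\<close>

definition selfadjoint :: "('a::complex_inner \<Rightarrow>\<^sub>L 'a) \<Rightarrow> bool" where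
  "selfadjoint T \<longleftrightarrow> T \<in> cbounded_ops \<and> (\<forall>x y. inner (T x) y = inner x (T y))"

text \<open>Only the real quadratic form enters, so this is a preorder that says nothing about
  symmetry; selfadjointness is carried separately where it matters.\<close>

definition op_le :: "('a::real_inner \<Rightarrow>\<^sub>L 'a) \<Rightarrow> ('a \<Rightarrow>\<^sub>L 'a) \<Rightarrow> bool" (infix "\<preceq>" 50) where
  "S \<preceq> T \<longleftrightarrow> (\<forall>x. inner (S x) x \<le> inner (T x) x)"

lemma op_leD: "S \<preceq> T \<Longrightarrow> inner (S x) x \<le> inner (T x) x"
  by (simp add: op_le_def)

lemma op_le_refl: "T \<preceq> T"
  by (simp add: op_le_def)

lemma op_le_trans [trans]: "S \<preceq> T \<Longrightarrow> T \<preceq> U \<Longrightarrow> S \<preceq> U"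
  by (meson op_le_def order_trans)

lemma selfadjointD:
  assumes "selfadjoint T"
  shows "T \<in> cbounded_ops" "inner (T x) y = inner x (T y)"
  using assms by (simp_all add: selfadjoint_def)

lemma selfadjoint_id: "selfadjoint id_blinfun"
  by (simp add: selfadjoint_def cbounded_ops_id)

lemma selfadjoint_add: "selfadjoint S \<Longrightarrow> selfadjoint T \<Longrightarrow> selfadjoint (S + T)"
  by (simp add: selfadjoint_def cbounded_ops_add blinfun.add_left inner_add_left inner_add_right)

lemma selfadjoint_diff: "selfadjoint S \<Longrightarrow> selfadjoint T \<Longrightarrow> selfadjoint (S - T)"
  by (simp add: selfadjoint_def cbounded_ops_diff blinfun.diff_left inner_diff_left inner_diff_right)

lemma selfadjoint_scaleR: "selfadjoint T \<Longrightarrow> selfadjoint (r *\<^sub>R T)"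
  by (simp add: selfadjoint_def cbounded_ops_scaleR blinfun.scaleR_left)

lemma selfadjoint_square: "selfadjoint T \<Longrightarrow> selfadjoint (T o\<^sub>L T)"
  by (simp add: selfadjoint_def cbounded_ops_compose)

lemma selfadjoint_lim:
  assumes "X \<longlonglongrightarrow> L" and "\<And>n. selfadjoint (X n)"
  shows "selfadjoint L"
proof -
  have "inner (L x) y = inner x (L y)" for x y
  proof (rule LIMSEQ_unique)
    show "(\<lambda>n. inner (X n x) y) \<longlonglongrightarrow> inner (L x) y"
      by (intro tendsto_intros assms)
    have "(\<lambda>n. inner x (X n y)) \<longlonglongrightarrow> inner x (L y)"
      by (intro tendsto_intros assms)
    then show "(\<lambda>n. inner (X n x) y) \<longlonglongrightarrow> inner x (L y)"
      by (simp add: selfadjointD(2)[OF assms(2)])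
  qed
  then show ?thesis
    using cbounded_ops_lim[OF assms(1)] assms(2) by (simp add: selfadjoint_def)
qed

lemma op_le_lim:
  assumes "X \<longlonglongrightarrow> L" and "\<And>n. S \<preceq> X n"
  shows "S \<preceq> L"
proof -
  have "inner (S x) x \<le> inner (L x) x" for x
  proof (rule LIMSEQ_le_const)
    show "(\<lambda>n. inner (X n x) x) \<longlonglongrightarrow> inner (L x) x"
      by (intro tendsto_intros assms)
  qed (use assms(2) in \<open>auto simp: op_le_def\<close>)
  then show ?thesis by (simp add: op_le_def)
qed

text \<open>A real-valued form means that the real quadratic form of \<open>\<i> T\<close> vanishes.
  Polarizing it yields symmetry of \<open>T\<close>. Conversely, \<open>\<i> T\<close> is skew for
  the real inner product if \<open>T\<close> is symmetric and complex-linear.\<close>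

lemma positive_op_iff:
  assumes T: "T \<in> cbounded_ops"
  shows "positive_op T \<longleftrightarrow> selfadjoint T \<and> (\<forall>x. 0 \<le> inner (T x) x)"
proof
  assume pos: "positive_op T"
  have nonneg: "0 \<le> inner (T x) x" and im: "inner (\<i> *\<^sub>C T x) x = 0" for x
    using pos Im_cinner[of "T x" x]
    by (auto simp: positive_op_def inner_cinner complex_nonneg_Reals_iff)
  have "inner (T x) y = inner (T y) x" for x y
  proof -
    \<comment> \<open>The two mixed terms of the form of \<open>\<i> T\<close> at
      \<open>x + \<i> y\<close> are exactly the defect of symmetry.\<close>
    have "inner (\<i> *\<^sub>C T (x + \<i> *\<^sub>C y)) (x + \<i> *\<^sub>C y) = inner (T x) y - inner (T y) x
       + inner (\<i> *\<^sub>C T x) x + inner (\<i> *\<^sub>C T (\<i> *\<^sub>C y)) (\<i> *\<^sub>C y)"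
      by (simp add: blinfun.add_right scaleC_add_right inner_add_left inner_add_right
          inner_diff_left cbounded_opsD[OF T] scaleC_imaginary_unit_twice inner_imaginary_unit scaleC_minus_right)
    then show ?thesis using im by simp
  qed
  with T nonneg show "selfadjoint T \<and> (\<forall>x. 0 \<le> inner (T x) x)"
    by (simp add: selfadjoint_def) (metis inner_commute)
next
  assume *: "selfadjoint T \<and> (\<forall>x. 0 \<le> inner (T x) x)"
  have "inner (\<i> *\<^sub>C T x) x = 0" for x
  proof -
    have "inner (\<i> *\<^sub>C T x) x = inner (\<i> *\<^sub>C x) (T x)"
      using * selfadjointD(2)[of T "\<i> *\<^sub>C x" x] by (simp add: cbounded_opsD[OF T])
    also have "\<dots> = inner (- x) (\<i> *\<^sub>C T x)"
      using inner_imaginary_unit[of "\<i> *\<^sub>C x" "T x"] by (simp add: scaleC_imaginary_unit_twice)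
    finally show ?thesis by (simp add: inner_commute)
  qed
  then show "positive_op T"
    using * by (simp add: positive_op_def complex_nonneg_Reals_iff Im_cinner flip: inner_cinner)
qed

lemma strongly_positive_iff:
  assumes T: "T \<in> cbounded_ops"
  shows "strongly_positive T \<longleftrightarrow> selfadjoint T \<and> (\<exists>\<delta>>0. \<delta> *\<^sub>R id_blinfun \<preceq> T)"
proof -
  have "positive_op (T - \<delta> *\<^sub>R id_blinfun) \<longleftrightarrow> selfadjoint T \<and> \<delta> *\<^sub>R id_blinfun \<preceq> T" for \<delta>
  proof -
    have "selfadjoint (T - \<delta> *\<^sub>R id_blinfun) \<longleftrightarrow> selfadjoint T"
      using selfadjoint_diff[of T "\<delta> *\<^sub>R id_blinfun"] selfadjoint_add[of "T - \<delta> *\<^sub>R id_blinfun" "\<delta> *\<^sub>R id_blinfun"]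
        selfadjoint_scaleR[OF selfadjoint_id, of \<delta>] by auto
    then show ?thesis
      by (subst positive_op_iff)
        (simp_all add: cbounded_ops_diff T cbounded_ops_scaleR cbounded_ops_id op_le_def
          blinfun.diff_left inner_diff_left)
  qed
  then show ?thesis by (auto simp: strongly_positive_def)
qed

section \<open>Norm bounds from the operator order\<close>

lemma positive_Cauchy_Schwarz:
  fixes T :: "'a::real_inner \<Rightarrow>\<^sub>L 'a"
  assumes "\<And>x y. inner (T x) y = inner x (T y)" and "\<And>x. 0 \<le> inner (T x) x"
  shows "(inner (T x) y)\<^sup>2 \<le> inner (T x) x * inner (T y) y"
proof -
  have *: "0 \<le> inner (T x) x - 2 * t * inner (T x) y + t\<^sup>2 * inner (T y) y" for t
    using assms(2)[of "x - t *\<^sub>R y"] assms(1)[of y x]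
    by (simp add: blinfun.diff_right blinfun.scaleR_right inner_diff_left inner_diff_right
        inner_commute power2_eq_square algebra_simps)
  show ?thesis
  proof (cases "inner (T y) y = 0")
    case False
    then have pos: "0 < inner (T y) y" using assms(2)[of y] by simp
    have "0 \<le> inner (T x) x - (inner (T x) y)\<^sup>2 / inner (T y) y"
      using *[of "inner (T x) y / inner (T y) y"] False by (simp add: power2_eq_square field_simps)
    then show ?thesis using pos by (simp add: field_simps)
  next
    case True
    have "inner (T x) y = 0"
    proof (rule ccontr)
      \<comment> \<open>The polynomial is now linear in \<open>t\<close>, and the chosen
        \<open>t\<close> gives it the value -1.\<close>
      assume "inner (T x) y \<noteq> 0"
      then show False
        using *[of "(inner (T x) x + 1) / (2 * inner (T x) y)"] True by simp
    qed
    with True show ?thesis by simp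
  qed
qed

text \<open>Cauchy-Schwarz for the form of \<open>T\<close>, taken at \<open>x\<close> and
  \<open>T x\<close>, replaces spectral theory. This is how order gaps become norm
  distances.\<close>

lemma norm_le_if_op_le:
  fixes T :: "'a::complex_inner \<Rightarrow>\<^sub>L 'a"
  assumes T: "selfadjoint T" and "0 \<preceq> T" "T \<preceq> c *\<^sub>R id_blinfun" and c: "0 \<le> c"
  shows "norm T \<le> c"
proof (rule norm_blinfun_bound[OF c])
  fix x
  have nonneg: "0 \<le> inner (T y) y" and le: "inner (T y) y \<le> c * (norm y)\<^sup>2" for y
    using op_leD[OF assms(2), of y] op_leD[OF assms(3), of y]
    by (simp_all add: blinfun.scaleR_left power2_norm_eq_inner)
  have "((norm (T x))\<^sup>2)\<^sup>2 \<le> inner (T x) x * inner (T (T x)) (T x)"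
    using positive_Cauchy_Schwarz[OF selfadjointD(2)[OF T] nonneg, of x "T x"]
    by (simp add: power2_norm_eq_inner)
  also have "\<dots> \<le> (c * (norm x)\<^sup>2) * (c * (norm (T x))\<^sup>2)"
    by (intro mult_mono le nonneg) (simp add: c)
  finally have "(norm (T x))\<^sup>2 * (norm (T x))\<^sup>2 \<le> (c * norm x)\<^sup>2 * (norm (T x))\<^sup>2"
    by (simp add: power2_eq_square algebra_simps)
  then have "(norm (T x))\<^sup>2 \<le> (c * norm x)\<^sup>2"
    by (cases "T x = 0") (simp, rule mult_right_le_imp_le[of _ "(norm (T x))\<^sup>2"], simp_all)
  then show "norm (T x) \<le> c * norm x"
    by (rule power2_le_imp_le) (simp add: c)
qed

lemma op_le_norm: "T \<preceq> norm T *\<^sub>R id_blinfun"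
  unfolding op_le_def
proof
  fix x
  have "inner (T x) x \<le> norm (T x) * norm x" by (rule norm_cauchy_schwarz)
  also have "\<dots> \<le> (norm T * norm x) * norm x"
    by (intro mult_right_mono norm_blinfun norm_ge_zero)
  finally show "inner (T x) x \<le> inner ((norm T *\<^sub>R id_blinfun) x) x"
    by (simp add: blinfun.scaleR_left dot_square_norm power2_eq_square mult.assoc)
qed

section \<open>Adjoints\<close>

text \<open>The representing vector minimizes \<open>(norm x)\<^sup>2 / 2 - f x\<close>.\<close>

lemma riesz_representation:
  fixes f :: "'a::{real_inner,banach} \<Rightarrow> real"
  assumes f: "bounded_linear f"
  shows "\<exists>y. \<forall>x. f x = inner x y"
proof -
  interpret f: bounded_linear f by (rule f)
  define J where "J x = (norm x)\<^sup>2 / 2 - f x" for x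
  obtain K where K: "\<And>x. norm (f x) \<le> norm x * K" using f.bounded by blast
  have low: "- (K\<^sup>2 / 2) \<le> J x" for x
  proof -
    have "0 \<le> (norm x - K)\<^sup>2" by simp
    moreover have "f x \<le> norm x * K" using K[of x] by simp
    ultimately show ?thesis by (simp add: J_def power2_diff field_simps)
  qed
  define m where "m = Inf (range J)"
  have bdd: "bdd_below (range J)" using low by (intro bdd_belowI[of _ "- (K\<^sup>2 / 2)"]) auto
  have m: "m \<le> J x" for x unfolding m_def by (rule cInf_lower[OF _ bdd]) simp
  have "\<exists>x. J x < m + inverse (real (Suc n))" for n
    using cInf_lessD[of "range J" "m + inverse (real (Suc n))"] by (auto simp: m_def)
  then obtain X where X: "\<And>n. J (X n) < m + inverse (real (Suc n))" by metis
  \<comment> \<open>The linear parts cancel, and the midpoint has value at least \<open>m\<close>;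
    hence two near-minimizers are close to each other.\<close>
  have parallelogram: "(norm (x - y))\<^sup>2 \<le> 4 * (J x - m) + 4 * (J y - m)" for x y
  proof -
    have "4 * J x + 4 * J y - 8 * J ((1/2) *\<^sub>R (x + y)) = (norm (x - y))\<^sup>2"
      unfolding J_def power2_norm_eq_inner
      by (simp add: f.add f.scaleR inner_add_left inner_add_right
          inner_diff_left inner_diff_right inner_commute field_simps)
    then show ?thesis using m[of "(1/2) *\<^sub>R (x + y)"] by simp
  qed
  have "Cauchy X"
  proof (rule metric_CauchyI)
    fix e :: real assume e: "0 < e"
    then obtain N where N: "inverse (real (Suc N)) < e\<^sup>2 / 8"
      using reals_Archimedean[of "e\<^sup>2 / 8"] by auto
    have "dist (X i) (X j) < e" if "i \<ge> N" "j \<ge> N" for i j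
    proof -
      have *: "inverse (real (Suc k)) \<le> inverse (real (Suc N))" if "k \<ge> N" for k
        using that by (simp add: field_simps)
      have "(norm (X i - X j))\<^sup>2 < e\<^sup>2"
      proof -
        have "J (X i) - m < e\<^sup>2 / 8" "J (X j) - m < e\<^sup>2 / 8"
          using X[of i] X[of j] *[OF that(1)] *[OF that(2)] N by linarith+
        then show ?thesis using parallelogram[of "X i" "X j"] by (simp add: field_simps)
      qed
      then show ?thesis
        unfolding dist_norm by (rule power2_less_imp_less) (use e in simp)
    qed
    then show "\<exists>M. \<forall>i\<ge>M. \<forall>j\<ge>M. dist (X i) (X j) < e" by blast
  qed
  then obtain y where y: "X \<longlonglongrightarrow> y" by (auto simp: Cauchy_convergent_iff convergent_def)
  have "(\<lambda>n. J (X n)) \<longlonglongrightarrow> J y"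
    unfolding J_def by (intro tendsto_intros f.tendsto y) simp
  moreover have "(\<lambda>n. J (X n)) \<longlonglongrightarrow> m"
  proof (rule tendsto_sandwich[OF _ _ tendsto_const])
    show "(\<lambda>n. m + inverse (real (Suc n))) \<longlonglongrightarrow> m"
      using tendsto_add[OF tendsto_const LIMSEQ_inverse_real_of_nat] by simp
  qed (intro always_eventually allI m less_imp_le[OF X])+
  ultimately have Jy: "J y = m" by (rule LIMSEQ_unique)
  have "f x = inner x y" for x
  proof -
    \<comment> \<open>Minimality of \<open>y\<close> along the line in direction \<open>x\<close>.
      Evaluated at its vertex \<open>t = - d / inner x x\<close>, the parabola forces
      \<open>d = 0\<close>.\<close>
    have quad: "0 \<le> t * (inner x y - f x) + t\<^sup>2 * inner x x / 2" for t
    proof -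
      have "J (y + t *\<^sub>R x) - J y = t * (inner x y - f x) + t\<^sup>2 * inner x x / 2"
        unfolding J_def power2_norm_eq_inner
        by (simp add: f.add f.scaleR inner_add_left inner_add_right inner_commute[of y x]
            power2_eq_square field_simps)
      then show ?thesis using m[of "y + t *\<^sub>R x"] Jy by simp
    qed
    show ?thesis
    proof (cases "x = 0")
      case False
      then have "0 < inner x x" by simp
      define d where "d = inner x y - f x"
      have "- (d / inner x x) * d + (- (d / inner x x))\<^sup>2 * inner x x / 2 = - (d\<^sup>2 / (2 * inner x x))"
        using False by (simp add: power2_eq_square field_simps)
      then have "d\<^sup>2 / (2 * inner x x) \<le> 0"
        using quad[of "- (d / inner x x)"] unfolding d_def by linarith
      then have "d = 0" using \<open>0 < inner x x\<close> by (auto simp: divide_le_0_iff not_less)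
      then show ?thesis by (simp add: d_def)
    qed (simp add: f.zero)
  qed
  then show ?thesis by blast
qed

text \<open>Riesz gives a representing vector \<open>g y\<close> for each \<open>y\<close>; its
  uniqueness makes \<open>g\<close> linear, and testing with \<open>x = g y\<close> bounds
  it.\<close>

lemma adjoint_exists:
  fixes T :: "'a::{real_inner,banach} \<Rightarrow>\<^sub>L 'b::real_inner"
  shows "\<exists>S :: 'b \<Rightarrow>\<^sub>L 'a. \<forall>x y. inner (T x) y = inner x (S y)"
proof -
  have "\<exists>z. \<forall>x. inner (T x) y = inner x z" for y
    by (rule riesz_representation)
      (rule bounded_linear_inner_left_comp[OF blinfun.bounded_linear_right])
  then obtain g where g: "\<And>x y. inner (T x) y = inner x (g y)" by metis
  have "bounded_linear g"
  proof (rule bounded_linear_intro)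
    show "g (x + y) = g x + g y" for x y
      by (rule vector_eq_ldot[THEN iffD1]) (simp add: inner_add_right flip: g)
    show "g (r *\<^sub>R x) = r *\<^sub>R g x" for r x
      by (rule vector_eq_ldot[THEN iffD1]) (simp flip: g)
    show "norm (g y) \<le> norm y * norm T" for y
    proof (cases "g y = 0")
      case False
      have "norm (g y) * norm (g y) = inner (T (g y)) y"
        by (simp add: g dot_square_norm power2_eq_square)
      also have "\<dots> \<le> norm (T (g y)) * norm y" by (rule norm_cauchy_schwarz)
      also have "\<dots> \<le> norm T * norm (g y) * norm y" by (intro mult_right_mono norm_blinfun) simp
      finally have "norm (g y) * norm (g y) \<le> (norm y * norm T) * norm (g y)" by (simp add: mult_ac)
      then show ?thesis using False by simp
    qed simp
  qed
  then show ?thesis using g by (intro exI[of _ "Blinfun g"]) (simp add: bounded_linear_Blinfun_apply)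
qed

text \<open>The imaginary part of \<open>cinner\<close> is a real inner product with
  \<open>\<i> x\<close>, and \<open>T\<close> commutes with \<open>\<i>\<close>; so a real adjoint
  is already a complex one.\<close>

lemma cinner_adjointI:
  assumes T: "T \<in> cbounded_ops" and "\<And>x y. inner (T x) y = inner x (S y)"
  shows "cinner (T x) y = cinner x (S y)"
  using assms(2)[of x y] assms(2)[of "\<i> *\<^sub>C x" y]
  by (intro complex_eqI) (simp_all only: Im_cinner cbounded_opsD[OF T] flip: inner_cinner)

lemma cadjoint_props:
  fixes T :: "'a::complex_hilbert \<Rightarrow>\<^sub>L 'b::complex_inner"
  assumes T: "T \<in> cbounded_ops"
  shows inner_cadjoint: "inner (T x) y = inner x (cadjoint T y)"
    and cadjoint_in_cbounded_ops: "cadjoint T \<in> cbounded_ops"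
proof -
  obtain S :: "'b \<Rightarrow>\<^sub>L 'a" where S: "\<And>x y. inner (T x) y = inner x (S y)"
    using adjoint_exists[of T] by blast
  have "cadjoint T = S"
    unfolding cadjoint_def
  proof (rule the_equality)
    fix S' :: "'b \<Rightarrow>\<^sub>L 'a" assume S': "\<forall>x y. cinner (T x) y = cinner x (S' y)"
    show "S' = S"
    proof (rule blinfun_eqI)
      show "S' y = S y" for y
        by (rule vector_eq_ldot[THEN iffD1]) (metis S S' inner_cinner)
    qed
  qed (simp add: cinner_adjointI[OF T S])
  moreover have "S (c *\<^sub>C y) = c *\<^sub>C S y" for c y
  proof (rule vector_eq_ldot[THEN iffD1], rule allI)
    fix x
    show "inner x (S (c *\<^sub>C y)) = inner x (c *\<^sub>C S y)"
      by (simp add: inner_cinner cinner_scaleC_right flip: cinner_adjointI[OF T S])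
  qed
  ultimately show "inner (T x) y = inner x (cadjoint T y)" "cadjoint T \<in> cbounded_ops"
    by (simp_all add: S cbounded_ops_def)
qed

section \<open>Inverses of coercive operators\<close>

lemma coercive_bounded_below:
  fixes T :: "'a::real_inner \<Rightarrow>\<^sub>L 'a"
  assumes T: "\<delta> *\<^sub>R id_blinfun \<preceq> T"
  shows "\<delta> * norm x \<le> norm (T x)"
proof (cases "x = 0")
  case False
  have "\<delta> * norm x * norm x \<le> inner (T x) x"
    using op_leD[OF T, of x] by (simp add: blinfun.scaleR_left dot_square_norm power2_eq_square)
  also have "\<dots> \<le> norm (T x) * norm x" by (rule norm_cauchy_schwarz)
  finally show ?thesis using False by simp
qed simp

text \<open>
  A right inverse is the fixed point of \<open>S \<mapsto> S + \<epsilon> (I - T S)\<close>, a contraction for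
  \<open>\<epsilon> = \<delta> / M\<^sup>2\<close> because coercivity with constant \<open>\<delta>\<close> and \<open>norm T \<le> M\<close> give
  \<open>norm (x - \<epsilon> T x)\<^sup>2 \<le> (1 - 2 \<epsilon> \<delta> + \<epsilon>\<^sup>2 M\<^sup>2) norm x\<^sup>2\<close>.
\<close>

lemma coercive_right_inverse:
  fixes T :: "'a::{real_inner,banach} \<Rightarrow>\<^sub>L 'a"
  assumes d: "0 < \<delta>" and T: "\<delta> *\<^sub>R id_blinfun \<preceq> T"
  shows "\<exists>S. T o\<^sub>L S = id_blinfun"
proof -
  \<comment> \<open>The extra \<open>\<delta>\<close> makes \<open>M\<close> positive and at least
    \<open>\<delta>\<close>, so that \<open>c\<close> below is nonnegative.\<close>
  define M where "M = norm T + \<delta>"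
  define \<epsilon> where "\<epsilon> = \<delta> / M\<^sup>2"
  \<comment> \<open>The value of \<open>1 - 2 \<epsilon> \<delta> + \<epsilon>^2 M^2\<close> at the
    chosen \<open>\<epsilon>\<close>.\<close>
  define c where "c = 1 - \<delta>\<^sup>2 / M\<^sup>2"
  have M: "\<delta> \<le> M" "norm T \<le> M" "0 < M" using d by (simp_all add: M_def add_nonneg_pos)
  have e: "0 < \<epsilon>" using d M by (simp add: \<epsilon>_def)
  have c: "0 \<le> c" "c < 1"
    using d M by (simp_all add: c_def power_mono)
  define E where "E = id_blinfun - \<epsilon> *\<^sub>R T"
  have "norm E \<le> sqrt c"
  proof (rule norm_blinfun_bound)
    fix x
    have "(norm (E x))\<^sup>2 = (norm x)\<^sup>2 - 2 * \<epsilon> * inner (T x) x + \<epsilon>\<^sup>2 * (norm (T x))\<^sup>2"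
      unfolding E_def power2_norm_eq_inner
      by (simp add: blinfun.diff_left blinfun.scaleR_left inner_diff_left
          inner_diff_right inner_commute power2_eq_square)
    also have "\<dots> \<le> (norm x)\<^sup>2 - 2 * \<epsilon> * (\<delta> * (norm x)\<^sup>2) + \<epsilon>\<^sup>2 * (M * norm x)\<^sup>2"
    proof -
      have "\<delta> * (norm x)\<^sup>2 \<le> inner (T x) x"
        using op_leD[OF T, of x] by (simp add: blinfun.scaleR_left power2_norm_eq_inner)
      moreover have "norm (T x) \<le> M * norm x"
        using norm_blinfun[of T x] mult_right_mono[OF M(2) norm_ge_zero[of x]] by linarith
      ultimately show ?thesis
        using e by (intro add_mono diff_mono mult_left_mono power_mono) auto
    qed
    also have "\<dots> = c * (norm x)\<^sup>2"
      using M by (simp add: \<epsilon>_def c_def power2_eq_square field_simps)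
    finally show "norm (E x) \<le> sqrt c * norm x"
      using real_le_rsqrt[of "norm (E x)" "c * (norm x)\<^sup>2"] by (simp add: real_sqrt_mult)
  qed (use c in simp)
  moreover have "sqrt c < 1" using c by simp
  ultimately have E: "norm E < 1" by linarith
  define f where "f S = S + \<epsilon> *\<^sub>R (id_blinfun - (T o\<^sub>L S))" for S :: "'a \<Rightarrow>\<^sub>L 'a"
  have "\<exists>!S. f S = S"
  proof (rule banach_fix_type[OF norm_ge_zero E], intro allI)
    fix S S' :: "'a \<Rightarrow>\<^sub>L 'a"
    have "f S - f S' = E o\<^sub>L (S - S')"
      by (rule blinfun_eqI) (simp add: f_def E_def blinfun.bilinear_simps algebra_simps)
    then show "dist (f S) (f S') \<le> norm E * dist S S'"
      by (simp add: dist_norm norm_blinfun_compose)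
  qed
  then obtain S where "f S = S" by blast
  then have "T o\<^sub>L S = id_blinfun" using e by (simp add: f_def)
  then show ?thesis by blast
qed

text \<open>Coercivity makes \<open>T\<close> injective, which turns the right inverse into a
  two-sided one and determines it, so the definite description in \<open>op_inverse\<close> denotes
  it.\<close>

lemma op_inverse_props:
  fixes T :: "'a::{real_inner,banach} \<Rightarrow>\<^sub>L 'a"
  assumes d: "0 < \<delta>" and T: "\<delta> *\<^sub>R id_blinfun \<preceq> T"
  shows op_inverse_left: "op_inverse T (T x) = x"
    and op_inverse_right: "T (op_inverse T x) = x"
    and norm_op_inverse: "norm (op_inverse T) \<le> inverse \<delta>"
proof -
  have inj: "x = y" if "T x = T y" for x y
    using coercive_bounded_below[OF T, of "x - y"] that d
    by (simp add: blinfun.diff_right mult_le_0_iff)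
  obtain S where S: "T o\<^sub>L S = id_blinfun" using coercive_right_inverse[OF assms] by blast
  then have r: "T (S x) = x" for x
    by (metis blinfun_apply_blinfun_compose blinfun_apply_id_blinfun)
  have l: "S (T x) = x" for x by (rule inj[OF r])
  have inv: "op_inverse T = S"
    unfolding op_inverse_def
  proof (rule the_equality)
    show "S o\<^sub>L T = id_blinfun \<and> T o\<^sub>L S = id_blinfun"
      using l by (auto intro: blinfun_eqI simp: S)
    fix S' assume "S' o\<^sub>L T = id_blinfun \<and> T o\<^sub>L S' = id_blinfun"
    then have "T (S' x) = T (S x)" for x
      by (metis r blinfun_apply_blinfun_compose blinfun_apply_id_blinfun)
    then show "S' = S" by (intro blinfun_eqI) (rule inj)
  qed
  show "op_inverse T (T x) = x" "T (op_inverse T x) = x" by (simp_all add: inv l r)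
  show "norm (op_inverse T) \<le> inverse \<delta>"
  proof (rule norm_blinfun_bound)
    show "norm (op_inverse T x) \<le> inverse \<delta> * norm x" for x
      using coercive_bounded_below[OF T, of "S x"] d by (simp add: inv r field_simps)
  qed (use d in simp)
qed

text \<open>Every vector is some \<open>T u\<close>, so linearity, symmetry and positivity are
  inherited from \<open>T\<close> by substitution.\<close>

lemma selfadjoint_op_inverse:
  fixes T :: "'a::complex_hilbert \<Rightarrow>\<^sub>L 'a"
  assumes sa: "selfadjoint T" and d: "0 < \<delta>" and T: "\<delta> *\<^sub>R id_blinfun \<preceq> T"
  shows "selfadjoint (op_inverse T)" and "0 \<preceq> op_inverse T"
proof -
  note inv = op_inverse_left[OF d T] op_inverse_right[OF d T]
  have "op_inverse T (c *\<^sub>C x) = c *\<^sub>C op_inverse T x" for c x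
    by (metis inv cbounded_opsD selfadjointD(1)[OF sa])
  moreover have "inner (op_inverse T x) y = inner x (op_inverse T y)" for x y
    by (metis inv selfadjointD(2)[OF sa])
  ultimately show "selfadjoint (op_inverse T)"
    by (simp add: selfadjoint_def cbounded_ops_def)
  have "0 \<le> inner (op_inverse T x) x" for x
  proof -
    have "0 \<le> \<delta> * inner (op_inverse T x) (op_inverse T x)" using d by simp
    also have "\<dots> \<le> inner (T (op_inverse T x)) (op_inverse T x)"
      using op_leD[OF T, of "op_inverse T x"] by (simp add: blinfun.scaleR_left)
    finally show ?thesis by (simp add: inv inner_commute)
  qed
  then show "0 \<preceq> op_inverse T" by (simp add: op_le_def)
qed

text \<open>With \<open>u = T\<^sup>-\<^sup>1 x\<close> and \<open>v = S\<^sup>-\<^sup>1 x\<close>, expand \<open>0 \<le> inner (S (s u - v)) (s u - v)\<close>.\<close>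

lemma op_inverse_antimono:
  fixes S T :: "'a::complex_hilbert \<Rightarrow>\<^sub>L 'a"
  assumes sa: "selfadjoint S" and d: "0 < \<delta>" and S: "\<delta> *\<^sub>R id_blinfun \<preceq> S"
    and T: "\<delta> *\<^sub>R id_blinfun \<preceq> T" and s: "0 \<le> s" and le: "s *\<^sub>R S \<preceq> T"
  shows "s *\<^sub>R op_inverse T \<preceq> op_inverse S"
proof -
  have "s * inner (op_inverse T x) x \<le> inner (op_inverse S x) x" for x
  proof -
    define u v where "u = op_inverse T x" and "v = op_inverse S x"
    have Tu: "T u = x" and Sv: "S v = x"
      by (simp_all add: u_def v_def op_inverse_right[OF d T] op_inverse_right[OF d S])
    define w where "w = s *\<^sub>R u - v"
    have "0 \<le> \<delta> * inner w w" using d by simp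
    also have "\<dots> \<le> inner (S w) w"
      using op_leD[OF S, of w] by (simp add: blinfun.scaleR_left)
    also have "\<dots> = s * (s * inner (S u) u) - 2 * s * inner u x + inner v x"
      using selfadjointD(2)[OF sa, of u v]
      by (simp add: w_def blinfun.diff_right blinfun.scaleR_right inner_diff_left inner_diff_right Sv
          inner_commute algebra_simps)
    \<comment> \<open>Here \<open>s S \<preceq> T\<close> enters, since \<open>T u = x\<close>. It
      leaves \<open>- s * inner u x + inner v x\<close> as an upper bound.\<close>
    also have "s * (s * inner (S u) u) \<le> s * inner u x"
      using op_leD[OF le, of u] s
      by (intro mult_left_mono) (simp_all add: blinfun.scaleR_left Tu inner_commute)
    finally show ?thesis by (simp add: u_def v_def)
  qed
  then show ?thesis by (simp add: op_le_def blinfun.scaleR_left)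
qed

text \<open>The resolvent identity \<open>S^-1 - T^-1 = S^-1 (T - S) T^-1\<close>.\<close>

lemma norm_op_inverse_diff:
  fixes S T :: "'a::{real_inner,banach} \<Rightarrow>\<^sub>L 'a"
  assumes d: "0 < \<delta>" and S: "\<delta> *\<^sub>R id_blinfun \<preceq> S" and T: "\<delta> *\<^sub>R id_blinfun \<preceq> T"
  shows "norm (op_inverse S - op_inverse T) \<le> inverse \<delta> * (norm (S - T) * inverse \<delta>)"
proof -
  have "op_inverse S - op_inverse T = op_inverse S o\<^sub>L ((T - S) o\<^sub>L op_inverse T)"
    by (rule blinfun_eqI)
      (simp add: blinfun.diff_left blinfun.diff_right op_inverse_left[OF d S] op_inverse_right[OF d T])
  also have "norm \<dots> \<le> norm (op_inverse S) * norm ((T - S) o\<^sub>L op_inverse T)"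
    by (rule norm_blinfun_compose)
  also have "norm ((T - S) o\<^sub>L op_inverse T) \<le> norm (T - S) * norm (op_inverse T)"
    by (rule norm_blinfun_compose)
  also have "norm (op_inverse S) * (norm (T - S) * norm (op_inverse T))
      \<le> inverse \<delta> * (norm (S - T) * inverse \<delta>)"
    using d by (subst norm_minus_commute)
      (intro mult_mono norm_op_inverse[OF d S] norm_op_inverse[OF d T] order_refl, auto)
  finally show ?thesis by (simp add: mult_left_mono)
qed

section \<open>Square roots\<close>

text \<open>
  Scaling reduces to \<open>P = I - T\<close> with \<open>norm T < 1\<close>. Then \<open>sqrt (I - T) = I - Y\<close>, where \<open>Y\<close> is
  the fixed point of \<open>Y \<mapsto> (T + Y\<^sup>2) / 2\<close>. The iteration stays inside the set of operators commuting
  with everything that commutes with \<open>P\<close>, which is what makes the root unique.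
\<close>

lemma square_root_exists:
  fixes P :: "'a::complex_hilbert \<Rightarrow>\<^sub>L 'a"
  assumes sa: "selfadjoint P" and d: "0 < \<delta>" and P: "\<delta> *\<^sub>R id_blinfun \<preceq> P"
  shows "\<exists>R. strongly_positive R \<and> R \<in> cbounded_ops \<and> R o\<^sub>L R = P \<and>
    (\<forall>S. S o\<^sub>L P = P o\<^sub>L S \<longrightarrow> S o\<^sub>L R = R o\<^sub>L S)"
proof -
  \<comment> \<open>With this \<open>c\<close>, both \<open>P \<preceq> c I\<close> and
    \<open>\<delta> \<le> c\<close> hold, so \<open>T = I - P / c\<close> lies between
    \<open>0\<close> and \<open>q I\<close> with \<open>0 \<le> q < 1\<close>.\<close>
  define c where "c = norm P + \<delta>"
  define q where "q = 1 - \<delta> / c"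
  have c: "0 < c" using d by (simp add: c_def add_nonneg_pos)
  have q: "0 \<le> q" "q < 1" using d c by (simp_all add: q_def c_def)
  define T where "T = id_blinfun - (1 / c) *\<^sub>R P"
  have saT: "selfadjoint T"
    unfolding T_def by (intro selfadjoint_diff selfadjoint_id selfadjoint_scaleR sa)
  have P_bounds: "\<delta> * inner x x \<le> inner (P x) x" "inner (P x) x \<le> c * inner x x" for x
  proof -
    show "\<delta> * inner x x \<le> inner (P x) x"
      using op_leD[OF P, of x] by (simp add: blinfun.scaleR_left)
    have "inner (P x) x \<le> norm P * inner x x"
      using op_leD[OF op_le_norm[of P], of x] by (simp add: blinfun.scaleR_left)
    also have "\<dots> \<le> c * inner x x" using d by (intro mult_right_mono) (simp_all add: c_def)
    finally show "inner (P x) x \<le> c * inner x x" .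
  qed
  have normT: "norm T \<le> q"
  proof (rule norm_le_if_op_le[OF saT])
    show "0 \<preceq> T" "T \<preceq> q *\<^sub>R id_blinfun"
      using P_bounds c by (simp_all add: op_le_def T_def q_def blinfun.diff_left blinfun.scaleR_left
          inner_diff_left field_simps)
  qed (rule q)
  have commT: "S o\<^sub>L T = T o\<^sub>L S" if "S o\<^sub>L P = P o\<^sub>L S" for S
  proof (rule blinfun_eqI)
    fix x
    have "S (P x) = P (S x)" using that by (metis blinfun_apply_blinfun_compose)
    then show "(S o\<^sub>L T) x = (T o\<^sub>L S) x"
      by (simp add: T_def blinfun.bilinear_simps)
  qed
  \<comment> \<open>The ball of radius \<open>q\<close> is mapped into itself since
    \<open>(q + q^2) / 2 \<le> q\<close>. On it \<open>f\<close> has Lipschitz constant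
    \<open>q\<close>, because \<open>Y^2 - Z^2 = Y (Y - Z) + (Y - Z) Z\<close> without
    commutativity.\<close>
  define X where "X = {Y. norm Y \<le> q \<and> selfadjoint Y \<and> (\<forall>S. S o\<^sub>L P = P o\<^sub>L S \<longrightarrow> S o\<^sub>L Y = Y o\<^sub>L S)}"
  define f where "f Y = (1/2) *\<^sub>R (T + (Y o\<^sub>L Y))" for Y :: "'a \<Rightarrow>\<^sub>L 'a"
  have "closed X"
    unfolding closed_sequential_limits
  proof (intro allI impI, elim conjE)
    fix Z L assume Z: "\<forall>n. Z n \<in> X" and L: "Z \<longlonglongrightarrow> L"
    have "norm L \<le> q"
      by (rule LIMSEQ_le_const2[OF tendsto_norm[OF L]]) (use Z in \<open>auto simp: X_def\<close>)
    moreover have "selfadjoint L"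
      by (rule selfadjoint_lim[OF L]) (use Z in \<open>auto simp: X_def\<close>)
    moreover have "S o\<^sub>L L = L o\<^sub>L S" if "S o\<^sub>L P = P o\<^sub>L S" for S
    proof (rule LIMSEQ_unique)
      show "(\<lambda>n. S o\<^sub>L Z n) \<longlonglongrightarrow> (S o\<^sub>L L)"
        by (intro bounded_bilinear.tendsto[OF bounded_bilinear_blinfun_compose] tendsto_const L)
      have "(\<lambda>n. Z n o\<^sub>L S) \<longlonglongrightarrow> (L o\<^sub>L S)"
        by (intro bounded_bilinear.tendsto[OF bounded_bilinear_blinfun_compose] tendsto_const L)
      moreover have "Z n o\<^sub>L S = S o\<^sub>L Z n" for n
        using Z that unfolding X_def by simp
      ultimately show "(\<lambda>n. S o\<^sub>L Z n) \<longlonglongrightarrow> (L o\<^sub>L S)" by simp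
    qed
    ultimately show "L \<in> X" by (simp add: X_def)
  qed
  then have "complete X" by (simp add: complete_eq_closed)
  moreover have "0 \<in> X"
    using q selfadjoint_scaleR[OF saT, of 0] by (simp add: X_def)
  moreover have "f ` X \<subseteq> X"
  proof
    fix Y' assume "Y' \<in> f ` X"
    then obtain Y where Y: "Y \<in> X" and Y': "Y' = f Y" by blast
    have "norm (Y o\<^sub>L Y) \<le> norm Y * norm Y" by (rule norm_blinfun_compose)
    also have "\<dots> \<le> q * 1" using Y q by (intro mult_mono) (auto simp: X_def)
    finally have "norm (T + (Y o\<^sub>L Y)) \<le> q + q"
      using normT by (intro norm_triangle_le add_mono) auto
    then have "norm (f Y) \<le> q" by (simp add: f_def)
    moreover have "selfadjoint (f Y)"
      unfolding f_def
      by (rule selfadjoint_scaleR[OF selfadjoint_add[OF saT selfadjoint_square]])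
        (use Y in \<open>simp add: X_def\<close>)
    moreover have "S o\<^sub>L f Y = f Y o\<^sub>L S" if S: "S o\<^sub>L P = P o\<^sub>L S" for S
    proof (rule blinfun_eqI)
      fix x
      have "S o\<^sub>L Y = Y o\<^sub>L S" using Y S by (simp add: X_def)
      then have "S (Y x) = Y (S x)" "S (T x) = T (S x)" for x
        using commT[OF S] by (metis blinfun_apply_blinfun_compose)+
      then show "(S o\<^sub>L f Y) x = (f Y o\<^sub>L S) x"
        by (simp add: f_def blinfun.bilinear_simps)
    qed
    ultimately show "Y' \<in> X" by (simp add: X_def Y')
  qed
  moreover have "dist (f Y) (f Z) \<le> q * dist Y Z" if "Y \<in> X" "Z \<in> X" for Y Z
  proof -
    have "f Y - f Z = (1/2) *\<^sub>R ((Y o\<^sub>L (Y - Z)) + ((Y - Z) o\<^sub>L Z))"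
      by (rule blinfun_eqI) (simp add: f_def blinfun.bilinear_simps algebra_simps)
    moreover have "norm (Y o\<^sub>L (Y - Z)) \<le> q * norm (Y - Z)"
      using that q by (intro order_trans[OF norm_blinfun_compose] mult_right_mono) (auto simp: X_def)
    moreover have "norm ((Y - Z) o\<^sub>L Z) \<le> norm (Y - Z) * q"
      using that q by (intro order_trans[OF norm_blinfun_compose] mult_left_mono) (auto simp: X_def)
    ultimately show ?thesis
      using norm_triangle_ineq[of "Y o\<^sub>L (Y - Z)" "(Y - Z) o\<^sub>L Z"] by (simp add: dist_norm mult.commute)
  qed
  ultimately obtain Y where Y: "Y \<in> X" "f Y = Y"
    using Banach_fix[of X q f] q by blast
  define R where "R = sqrt c *\<^sub>R (id_blinfun - Y)"
  have saR: "selfadjoint R"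
    using Y(1) unfolding R_def X_def
    by (intro selfadjoint_scaleR selfadjoint_diff selfadjoint_id) simp
  have "(sqrt c * (1 - q)) *\<^sub>R id_blinfun \<preceq> R"
    unfolding op_le_def
  proof
    fix x
    have "inner (Y x) x \<le> norm Y * inner x x"
      using op_leD[OF op_le_norm[of Y], of x] by (simp add: blinfun.scaleR_left)
    also have "\<dots> \<le> q * inner x x" using Y(1) by (intro mult_right_mono) (auto simp: X_def)
    finally have "sqrt c * ((1 - q) * inner x x) \<le> sqrt c * inner (x - Y x) x"
      using c by (intro mult_left_mono) (simp_all add: inner_diff_left algebra_simps)
    then show "inner (((sqrt c * (1 - q)) *\<^sub>R id_blinfun) x) x \<le> inner (R x) x"
      by (simp add: R_def blinfun.scaleR_left blinfun.diff_left)
  qed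
  then have "strongly_positive R"
    using saR c q selfadjointD(1)[OF saR]
    by (subst strongly_positive_iff) (auto intro!: exI[of _ "sqrt c * (1 - q)"])
  moreover have "R o\<^sub>L R = P"
  proof (rule blinfun_eqI)
    fix x
    have "f Y x = Y x" by (simp add: Y(2))
    \<comment> \<open>The fixed-point equation reads
      \<open>(I - Y)^2 = I - T = P / c\<close>.\<close>
    then have "2 *\<^sub>R ((1/2) *\<^sub>R (T x + Y (Y x))) = 2 *\<^sub>R Y x"
      by (simp add: f_def blinfun.add_left blinfun.scaleR_left del: scaleR_scaleR)
    then have "Y (Y x) = Y x + Y x - T x" by (simp add: scaleR_2 algebra_simps)
    then have "(R o\<^sub>L R) x = c *\<^sub>R (x - T x)"
      using c by (simp add: R_def blinfun.bilinear_simps) (simp add: algebra_simps)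
    also have "\<dots> = P x" using c by (simp add: T_def blinfun.bilinear_simps)
    finally show "(R o\<^sub>L R) x = P x" .
  qed
  moreover have "S o\<^sub>L R = R o\<^sub>L S" if "S o\<^sub>L P = P o\<^sub>L S" for S
  proof (rule blinfun_eqI)
    fix x
    have "S o\<^sub>L Y = Y o\<^sub>L S" using Y(1) that by (simp add: X_def)
    then have "S (Y x) = Y (S x)" by (metis blinfun_apply_blinfun_compose)
    then show "(S o\<^sub>L R) x = (R o\<^sub>L S) x" by (simp add: R_def blinfun.bilinear_simps)
  qed
  ultimately show ?thesis using selfadjointD(1)[OF saR] by blast
qed

text \<open>Any root \<open>S\<close> commutes with \<open>P = S^2\<close>, hence with the
  constructed root \<open>R\<close>. So \<open>(S + R) (S - R) = S^2 - R^2 = 0\<close>, and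
  \<open>S + R\<close> is coercive, hence injective.\<close>

lemma square_root_unique:
  fixes P :: "'a::complex_hilbert \<Rightarrow>\<^sub>L 'a"
  assumes "strongly_positive P" "P \<in> cbounded_ops"
  shows "\<exists>!R. R \<in> cbounded_ops \<and> strongly_positive R \<and> R o\<^sub>L R = P"
proof -
  obtain \<delta> where d: "0 < \<delta>" "\<delta> *\<^sub>R id_blinfun \<preceq> P" and sa: "selfadjoint P"
    using assms strongly_positive_iff by blast
  obtain R where R: "strongly_positive R" "R \<in> cbounded_ops" "R o\<^sub>L R = P"
    and comm: "\<And>S. S o\<^sub>L P = P o\<^sub>L S \<Longrightarrow> S o\<^sub>L R = R o\<^sub>L S"
    using square_root_exists[OF sa d] by blast
  have "S = R" if S: "S \<in> cbounded_ops" "strongly_positive S" "S o\<^sub>L S = P" for S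
  proof (rule blinfun_eqI)
    fix x
    have "S o\<^sub>L P = P o\<^sub>L S" by (simp add: blinfun_eqI flip: S(3))
    then have "S (R x) = R (S x)" using comm by (metis blinfun_apply_blinfun_compose)
    moreover have "S (S x) = R (R x)" using S(3) R(3) by (metis blinfun_apply_blinfun_compose)
    ultimately have zero: "(S + R) (S x - R x) = 0" by (simp add: blinfun.bilinear_simps)
    obtain a where a: "0 < a" "a *\<^sub>R id_blinfun \<preceq> S" using S strongly_positive_iff by blast
    obtain b where b: "0 < b" "b *\<^sub>R id_blinfun \<preceq> R" using R strongly_positive_iff by blast
    have "(a + b) *\<^sub>R id_blinfun \<preceq> S + R"
      using a(2) b(2) by (auto simp: op_le_def blinfun.bilinear_simps inner_add_left distrib_right
          intro: add_mono)
    from coercive_bounded_below[OF this, of "S x - R x"] show "S x = R x"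
      using a(1) b(1) zero by (simp add: mult_le_0_iff)
  qed
  with R show ?thesis by blast
qed

lemma strongly_positive_square:
  fixes R :: "'a::complex_hilbert \<Rightarrow>\<^sub>L 'a"
  assumes "strongly_positive R" "R \<in> cbounded_ops"
  shows "strongly_positive (R o\<^sub>L R)"
proof -
  obtain \<delta> where d: "0 < \<delta>" "\<delta> *\<^sub>R id_blinfun \<preceq> R" and sa: "selfadjoint R"
    using assms strongly_positive_iff by blast
  have "\<delta>\<^sup>2 *\<^sub>R id_blinfun \<preceq> R o\<^sub>L R"
    unfolding op_le_def
  proof
    fix x
    have "(\<delta> * norm x)\<^sup>2 \<le> (norm (R x))\<^sup>2"
      using coercive_bounded_below[OF d(2), of x] d(1) by (intro power_mono) auto
    then show "inner ((\<delta>\<^sup>2 *\<^sub>R id_blinfun) x) x \<le> inner ((R o\<^sub>L R) x) x"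
      by (simp add: blinfun.scaleR_left selfadjointD(2)[OF sa] dot_square_norm power_mult_distrib)
  qed
  then show ?thesis
    using d(1) selfadjoint_square[OF sa] selfadjointD(1)
    by (subst strongly_positive_iff) (auto intro!: exI[of _ "\<delta>\<^sup>2"])
qed

section \<open>Operators on square summable sequences\<close>

text \<open>Sums of series are unique, so a block matrix has at most one operator; this resolves the
  definite description in \<open>block_op\<close>.\<close>

lemma block_op_eqI:
  assumes "has_blocks T M"
  shows "block_op M = T"
  unfolding block_op_def
proof (rule the_equality)
  show "T' = T" if "has_blocks T' M" for T'
    using assms that unfolding has_blocks_def
    by (intro blinfun_eqI ell2_eqI) (metis sums_unique2)
qed (rule assms)

lemma summable_blinfun_ell2:
  fixes q :: "'a::real_inner \<Rightarrow>\<^sub>L 'b::real_inner"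
  shows "summable (\<lambda>k. (norm (q (ell2_nth x k)))\<^sup>2)"
proof (rule summable_comparison_test')
  show "summable (\<lambda>k. (norm q)\<^sup>2 * (norm (ell2_nth x k))\<^sup>2)"
    by (intro summable_mult summable_ell2)
  show "norm ((norm (q (ell2_nth x n)))\<^sup>2) \<le> (norm q)\<^sup>2 * (norm (ell2_nth x n))\<^sup>2" for n
    using power_mono[OF norm_blinfun[of q "ell2_nth x n"] norm_ge_zero, of 2]
    by (simp add: power_mult_distrib)
qed

lemma bounded_linear_ell2_map:
  fixes q :: "'a::real_inner \<Rightarrow>\<^sub>L 'b::real_inner"
  shows "bounded_linear (\<lambda>x. Abs_ell2 (\<lambda>k. q (ell2_nth x k)))"
    and "norm (Abs_ell2 (\<lambda>k. q (ell2_nth x k))) \<le> norm q * norm x"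
proof -
  have nth: "ell2_nth (Abs_ell2 (\<lambda>k. q (ell2_nth x k))) = (\<lambda>k. q (ell2_nth x k))" for x
    by (simp add: Abs_ell2_inverse summable_blinfun_ell2)
  show bound: "norm (Abs_ell2 (\<lambda>k. q (ell2_nth x k))) \<le> norm q * norm x" for x
  proof (rule power2_le_imp_le)
    have "(norm (Abs_ell2 (\<lambda>k. q (ell2_nth x k))))\<^sup>2 = (\<Sum>k. (norm (q (ell2_nth x k)))\<^sup>2)"
      by (simp add: norm_ell2_sq nth)
    also have "\<dots> \<le> (\<Sum>k. (norm q)\<^sup>2 * (norm (ell2_nth x k))\<^sup>2)"
    proof (rule suminf_le)
      show "(norm (q (ell2_nth x k)))\<^sup>2 \<le> (norm q)\<^sup>2 * (norm (ell2_nth x k))\<^sup>2" for k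
        using power_mono[OF norm_blinfun[of q "ell2_nth x k"] norm_ge_zero, of 2]
        by (simp add: power_mult_distrib)
    qed (intro summable_blinfun_ell2 summable_mult summable_ell2)+
    also have "\<dots> = (norm q * norm x)\<^sup>2"
      by (simp add: suminf_mult norm_ell2_sq power_mult_distrib)
    finally show "(norm (Abs_ell2 (\<lambda>k. q (ell2_nth x k))))\<^sup>2 \<le> (norm q * norm x)\<^sup>2" .
  qed simp
  show "bounded_linear (\<lambda>x. Abs_ell2 (\<lambda>k. q (ell2_nth x k)))"
  proof (rule bounded_linear_intro[where K = "norm q"])
    show "norm (Abs_ell2 (\<lambda>k. q (ell2_nth x k))) \<le> norm x * norm q" for x
      using bound by (simp add: mult.commute)
  qed (rule ell2_eqI, simp only: nth,
      simp add: nth plus_ell2.rep_eq scaleR_ell2.rep_eq blinfun.bilinear_simps)+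
qed

lemma
  fixes q :: "'a::real_inner \<Rightarrow>\<^sub>L 'a"
  shows ell2_nth_diag_op: "ell2_nth (diag_op q x) k = q (ell2_nth x k)"
    and norm_diag_op: "norm (diag_op q) \<le> norm q"
proof -
  define T where "T = Blinfun (\<lambda>x. Abs_ell2 (\<lambda>k. q (ell2_nth x k)))"
  have T: "T x = Abs_ell2 (\<lambda>k. q (ell2_nth x k))" for x
    by (simp add: T_def bounded_linear_Blinfun_apply bounded_linear_ell2_map)
  then have nth: "ell2_nth (T x) k = q (ell2_nth x k)" for x k
    by (simp add: Abs_ell2_inverse summable_blinfun_ell2)
  have "diag_op q = T"
    unfolding diag_op_def
  proof (rule block_op_eqI, unfold has_blocks_def, intro allI)
    fix x j
    have "(\<lambda>k. (if j = k then q else 0) (ell2_nth x k)) = (\<lambda>k. if k = j then q (ell2_nth x k) else 0)"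
      by auto
    then show "(\<lambda>k. (if j = k then q else 0) (ell2_nth x k)) sums ell2_nth (T x) j"
      using sums_single[of j "\<lambda>k. q (ell2_nth x k)"] by (simp add: nth)
  qed
  then show "ell2_nth (diag_op q x) k = q (ell2_nth x k)" "norm (diag_op q) \<le> norm q"
    by (simp_all add: nth) (intro norm_blinfun_bound, simp_all add: T bounded_linear_ell2_map)
qed

lemma inner_diag_op: "inner (diag_op q x) y = (\<Sum>k. inner (q (ell2_nth x k)) (ell2_nth y k))"
  by (simp add: inner_ell2_def ell2_nth_diag_op)

lemma summable_inner_diag_op:
  fixes q :: "'a::real_inner \<Rightarrow>\<^sub>L 'a"
  shows "summable (\<lambda>k. inner (q (ell2_nth x k)) (ell2_nth y k))"
  using summable_inner_ell2[of "diag_op q x" y] by (simp add: ell2_nth_diag_op)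

lemma diag_op_diff: "diag_op (S - T) = diag_op S - diag_op T"
  by (intro blinfun_eqI ell2_eqI) (simp add: ell2_nth_diag_op blinfun.diff_left minus_ell2.rep_eq)

lemma diag_op_scaleR: "diag_op (r *\<^sub>R T) = r *\<^sub>R diag_op T"
  by (intro blinfun_eqI ell2_eqI) (simp add: ell2_nth_diag_op blinfun.scaleR_left scaleR_ell2.rep_eq)

lemma diag_op_id: "diag_op id_blinfun = id_blinfun"
  by (intro blinfun_eqI ell2_eqI) (simp add: ell2_nth_diag_op)

lemma diag_op_compose: "diag_op (S o\<^sub>L T) = diag_op S o\<^sub>L diag_op T"
  by (intro blinfun_eqI ell2_eqI) (simp add: ell2_nth_diag_op)

lemma diag_op_mono: "S \<preceq> T \<Longrightarrow> diag_op S \<preceq> diag_op T"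
  unfolding op_le_def inner_diag_op
  by (intro allI suminf_le summable_inner_diag_op) simp

lemma diag_op_in_cbounded_ops: "T \<in> cbounded_ops \<Longrightarrow> diag_op T \<in> cbounded_ops"
  unfolding cbounded_ops_def
  by (auto intro!: ell2_eqI simp: ell2_nth_diag_op scaleC_ell2.rep_eq)

lemma selfadjoint_diag_op: "selfadjoint T \<Longrightarrow> selfadjoint (diag_op T)"
  unfolding selfadjoint_def
  by (simp add: diag_op_in_cbounded_ops inner_commute[of _ "diag_op T _"] inner_diag_op)
    (simp add: inner_commute)

section \<open>Single coordinates and shifts\<close>

definition ell2_single :: "nat \<Rightarrow> 'a \<Rightarrow> 'a::real_inner ell2" where
  "ell2_single j h = Abs_ell2 (\<lambda>k. if k = j then h else 0)"

lemma ell2_nth_single: "ell2_nth (ell2_single j h) k = (if k = j then h else 0)"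
proof -
  have "(\<lambda>k. (norm (if k = j then h else 0))\<^sup>2) = (\<lambda>k. if k = j then (norm h)\<^sup>2 else 0)" by auto
  then have "summable (\<lambda>k. (norm (if k = j then h else 0))\<^sup>2)"
    using sums_single[of j "\<lambda>_. (norm h)\<^sup>2"] by (simp add: sums_iff)
  then show ?thesis by (simp add: ell2_single_def Abs_ell2_inverse)
qed

lemma inner_ell2_single: "inner x (ell2_single j h) = inner (ell2_nth x j) h"
proof -
  have "(\<lambda>k. inner (ell2_nth x k) (ell2_nth (ell2_single j h) k))
      = (\<lambda>k. if k = j then inner (ell2_nth x k) h else 0)"
    by (auto simp: ell2_nth_single)
  then show ?thesis
    using sums_unique[OF sums_single[of j "\<lambda>k. inner (ell2_nth x k) h"]] by (simp add: inner_ell2_def)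
qed

text \<open>Tested on sequences with one nonzero entry. Estimates are made for the operators
  \<open>U\<close> on sequences; in their differences \<open>A22\<close> cancels, and the remaining
  diagonal inequality is brought back to the space of coefficients.\<close>

lemma op_le_if_diag_op_le: "diag_op S \<preceq> diag_op T \<Longrightarrow> S \<preceq> T"
  unfolding op_le_def
  by (metis (no_types, lifting) ell2_nth_diag_op ell2_nth_single inner_ell2_single)

lemma bounded_linear_ell2_nth: "bounded_linear (\<lambda>x. ell2_nth x k)"
  by (rule bounded_linear_intro[where K = 1])
    (simp_all add: plus_ell2.rep_eq scaleR_ell2.rep_eq norm_ell2_nth_le)

lemma bounded_linear_ell2_single: "bounded_linear (ell2_single j)"
proof (rule bounded_linear_intro[where K = 1])
  show "norm (ell2_single j h) \<le> norm h * 1" for h :: 'a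
    using inner_ell2_single[of "ell2_single j h" j h]
    by (simp add: norm_eq_sqrt_inner ell2_nth_single)
qed (auto intro!: ell2_eqI simp: ell2_nth_single plus_ell2.rep_eq scaleR_ell2.rep_eq)

lemma ell2_shift_exists: "\<exists>S :: 'a::real_inner ell2 \<Rightarrow>\<^sub>L 'a ell2. \<forall>x k. ell2_nth (S x) k = ell2_nth x (k + n)"
proof -
  have nth: "ell2_nth (Abs_ell2 (\<lambda>k. ell2_nth x (k + n))) = (\<lambda>k. ell2_nth x (k + n))" for x :: "'a ell2"
    using summable_iff_shift[of "\<lambda>k. (norm (ell2_nth x k))\<^sup>2" n] by (simp add: Abs_ell2_inverse)
  have "bounded_linear (\<lambda>x :: 'a ell2. Abs_ell2 (\<lambda>k. ell2_nth x (k + n)))"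
  proof (rule bounded_linear_intro[where K = 1])
    fix x :: "'a ell2"
    have "(\<Sum>k. (norm (ell2_nth x (k + n)))\<^sup>2) \<le> (norm x)\<^sup>2"
      unfolding norm_ell2_sq suminf_split_initial_segment[OF summable_ell2, of x n]
      by (simp add: sum_nonneg)
    then show "norm (Abs_ell2 (\<lambda>k. ell2_nth x (k + n))) \<le> norm x * 1"
      by (simp add: power2_le_imp_le norm_ell2_sq[of "Abs_ell2 _"] nth)
  qed (rule ell2_eqI, simp only: nth, simp add: nth plus_ell2.rep_eq scaleR_ell2.rep_eq)+
  from bounded_linear_Blinfun_apply[OF this] nth show ?thesis by (metis (no_types, lifting))
qed

section \<open>The blocks of a bounded Hankel matrix\<close>

text \<open>
  Row and column 1 of the Hankel matrix, counted from 0, are \<open>\<gamma> 2, \<gamma> 3, \<dots>\<close>, and deleting its first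
  two rows leaves the matrix of \<open>Gamma_1\<close>. This gives the boundedness of all three blocks.
\<close>

locale bounded_hankel =
  fixes \<gamma> :: "nat \<Rightarrow> 'a::complex_hilbert \<Rightarrow>\<^sub>L 'b::complex_hilbert"
  assumes cbounded: "\<And>k. k \<ge> 1 \<Longrightarrow> \<gamma> k \<in> cbounded_ops"
    and bounded: "bounded_blocks (hankel \<gamma>)"
begin

text \<open>Complex linearity passes through the series of row \<open>j\<close> of the Hankel matrix
  term by term. It serves \<open>B_r\<close> and every row of \<open>Gamma_1\<close>.\<close>

lemma sums_cbounded_ops:
  assumes "\<And>x. (\<lambda>k. \<gamma> (k + j + 1) (ell2_nth x k)) sums T x"
  shows "T (c *\<^sub>C x) = c *\<^sub>C T x"
proof -
  have "(\<lambda>k. c *\<^sub>C \<gamma> (k + j + 1) (ell2_nth x k)) sums (c *\<^sub>C T x)"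
    by (intro bounded_linear.sums[OF bounded_linear_scaleC] assms)
  moreover have "\<gamma> (k + j + 1) (ell2_nth (c *\<^sub>C x) k) = c *\<^sub>C \<gamma> (k + j + 1) (ell2_nth x k)" for k
    by (simp add: scaleC_ell2.rep_eq cbounded_opsD[OF cbounded])
  ultimately show ?thesis using assms[of "c *\<^sub>C x"] by (simp add: sums_unique2)
qed

lemma B_r_in_cbounded_ops: "B_r \<gamma> \<in> cbounded_ops"
proof -
  obtain G where G: "has_blocks G (hankel \<gamma>)" using bounded by (auto simp: bounded_blocks_def)
  define T where "T = Blinfun (\<lambda>x. ell2_nth (G x) 1)"
  have "T x = ell2_nth (G x) 1" for x
    unfolding T_def
    by (simp add: bounded_linear_Blinfun_apply
        bounded_linear_compose[OF bounded_linear_ell2_nth blinfun.bounded_linear_right])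
  moreover have "(\<lambda>k. \<gamma> (k + 2) (ell2_nth x k)) sums ell2_nth (G x) 1" for x
    using G[unfolded has_blocks_def, rule_format, of 1 x] by (simp add: hankel_def add.commute)
  ultimately have T: "(\<lambda>k. \<gamma> (k + 2) (ell2_nth x k)) sums T x" for x by simp
  have "B_r \<gamma> = T"
    unfolding B_r_def row_op_def
    by (rule the_equality) (use T in \<open>auto intro!: blinfun_eqI intro: sums_unique2\<close>)
  moreover have "T (c *\<^sub>C x) = c *\<^sub>C T x" for c x
    by (rule sums_cbounded_ops[of 1]) (use T in \<open>simp add: numeral_2_eq_2\<close>)
  ultimately show ?thesis by (simp add: cbounded_ops_def)
qed

lemma B_c_in_cbounded_ops: "B_c \<gamma> \<in> cbounded_ops"
proof -
  obtain G where G: "has_blocks G (hankel \<gamma>)" using bounded by (auto simp: bounded_blocks_def)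
  define T where "T = Blinfun (\<lambda>h. G (ell2_single 1 h))"
  have T_apply: "T h = G (ell2_single 1 h)" for h
    unfolding T_def
    by (simp add: bounded_linear_Blinfun_apply
        bounded_linear_compose[OF blinfun.bounded_linear_right bounded_linear_ell2_single])
  have T: "ell2_nth (T h) k = \<gamma> (k + 2) h" for h k
  proof -
    have "(\<lambda>i. hankel \<gamma> k i (ell2_nth (ell2_single 1 h) i)) = (\<lambda>i. if i = 1 then hankel \<gamma> k i h else 0)"
      by (auto simp: ell2_nth_single)
    then have "(\<lambda>i. if i = 1 then hankel \<gamma> k i h else 0) sums ell2_nth (T h) k"
      using G by (simp add: has_blocks_def T_apply) metis
    then show ?thesis
      using sums_unique2[OF _ sums_single[of 1 "\<lambda>i. hankel \<gamma> k i h"]] by (simp add: hankel_def)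
  qed
  have "B_c \<gamma> = T"
    unfolding B_c_def col_op_def
    by (rule the_equality) (auto simp: T intro!: blinfun_eqI ell2_eqI)
  moreover have "T (c *\<^sub>C h) = c *\<^sub>C T h" for c h
    by (rule ell2_eqI) (simp add: T scaleC_ell2.rep_eq cbounded_opsD[OF cbounded])
  ultimately show ?thesis by (simp add: cbounded_ops_def)
qed

lemma Gamma_1_in_cbounded_ops: "Gamma_1 \<gamma> \<in> cbounded_ops"
proof -
  obtain G where G: "has_blocks G (hankel \<gamma>)" using bounded by (auto simp: bounded_blocks_def)
  obtain S :: "'b ell2 \<Rightarrow>\<^sub>L 'b ell2" where S: "\<And>x k. ell2_nth (S x) k = ell2_nth x (k + 2)"
    using ell2_shift_exists[of 2] by blast
  have T: "(\<lambda>k. \<gamma> (k + (j + 2) + 1) (ell2_nth x k)) sums ell2_nth ((S o\<^sub>L G) x) j" for x j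
    using G[unfolded has_blocks_def, rule_format, of "j + 2" x] by (simp add: hankel_def S add_ac)
  have "Gamma_1 \<gamma> = S o\<^sub>L G"
    unfolding Gamma_1_def
    by (rule block_op_eqI) (use T in \<open>simp add: has_blocks_def hankel_def add_ac\<close>)
  moreover have "(S o\<^sub>L G) (c *\<^sub>C x) = c *\<^sub>C (S o\<^sub>L G) x" for c x
    by (rule ell2_eqI, subst scaleC_ell2.rep_eq, rule sums_cbounded_ops[OF T])
  ultimately show ?thesis unfolding cbounded_ops_def by simp
qed

lemma blocks_in_cbounded_ops:
  "A11 \<gamma> \<in> cbounded_ops" "A12 \<gamma> \<in> cbounded_ops" "A22 \<gamma> \<in> cbounded_ops"
  unfolding A11_def A12_def A22_def
  by (intro cbounded_ops_add cbounded_ops_compose cadjoint_in_cbounded_ops cbounded[OF order_refl]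
      B_r_in_cbounded_ops B_c_in_cbounded_ops Gamma_1_in_cbounded_ops)+

end

section \<open>The iteration\<close>

text \<open>The constant \<open>\<delta>\<close> is fixed as a parameter because one coercivity
  bound serves all \<open>U P\<close> with \<open>P\<close> above \<open>A11\<close>.\<close>

locale coercive_hankel = bounded_hankel +
  fixes \<delta> :: real
  assumes selfadjoint_A11: "selfadjoint (A11 \<gamma>)"
    and selfadjoint_A22: "selfadjoint (A22 \<gamma>)"
    and A22_nonneg: "0 \<preceq> A22 \<gamma>"
    and delta_pos: "0 < \<delta>"
    and coercive: "\<delta> *\<^sub>R id_blinfun \<preceq> diag_op (A11 \<gamma>) - A22 \<gamma>"
begin

abbreviation U :: "('a \<Rightarrow>\<^sub>L 'a) \<Rightarrow> 'a ell2 \<Rightarrow>\<^sub>L 'a ell2" where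
  "U P \<equiv> diag_op P - A22 \<gamma>"

abbreviation F :: "('a \<Rightarrow>\<^sub>L 'a) \<Rightarrow> 'a \<Rightarrow>\<^sub>L 'a" where
  "F P \<equiv> rhs \<gamma> (diag_op P)"

text \<open>The domain on which \<open>F\<close> is studied: \<open>F\<close> maps it into itself
  and reverses the order there, and it contains all approximations and all solutions.\<close>

definition admissible :: "('a \<Rightarrow>\<^sub>L 'a) \<Rightarrow> bool" where
  "admissible P \<longleftrightarrow> selfadjoint P \<and> A11 \<gamma> \<preceq> P"

lemma U_mono: "P \<preceq> P' \<Longrightarrow> U P \<preceq> U P'"
  using diag_op_mono[of P P'] by (simp add: op_le_def blinfun.diff_left inner_diff_left)

lemma admissible_coercive: "admissible P \<Longrightarrow> \<delta> *\<^sub>R id_blinfun \<preceq> U P"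
  using op_le_trans[OF coercive U_mono] by (simp add: admissible_def)

lemma selfadjoint_U: "selfadjoint P \<Longrightarrow> selfadjoint (U P)"
  by (intro selfadjoint_diff selfadjoint_diag_op selfadjoint_A22)

lemma inner_rhs:
  "inner (rhs \<gamma> Q x) y = inner (A11 \<gamma> x) y
    + inner (op_inverse (Q - A22 \<gamma>) (cadjoint (A12 \<gamma>) x)) (cadjoint (A12 \<gamma>) y)"
  by (simp add: rhs_def blinfun.add_left inner_add_left inner_cadjoint[OF blocks_in_cbounded_ops(2)])

text \<open>The constant \<open>\<epsilon>\<close> is arbitrary because a solution comes with its
  own coercivity constant before it is known to be admissible.\<close>

lemma admissible_rhs:
  assumes sa: "selfadjoint (Q - A22 \<gamma>)" and e: "0 < \<epsilon>" "\<epsilon> *\<^sub>R id_blinfun \<preceq> Q - A22 \<gamma>"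
  shows "admissible (rhs \<gamma> Q)"
proof -
  note inv = selfadjoint_op_inverse[OF sa e]
  have "rhs \<gamma> Q \<in> cbounded_ops"
    unfolding rhs_def
    by (intro cbounded_ops_add cbounded_ops_compose cadjoint_in_cbounded_ops blocks_in_cbounded_ops
        selfadjointD(1)[OF inv(1)])
  moreover have "inner (rhs \<gamma> Q x) y = inner x (rhs \<gamma> Q y)" for x y
  proof -
    have "inner (rhs \<gamma> Q x) y = inner (rhs \<gamma> Q y) x"
      unfolding inner_rhs by (metis inner_commute inv(1) selfadjointD(2) selfadjoint_A11)
    then show ?thesis by (simp add: inner_commute)
  qed
  moreover have "A11 \<gamma> \<preceq> rhs \<gamma> Q"
    using inv(2) by (simp add: op_le_def inner_rhs)
  ultimately show ?thesis by (simp add: admissible_def selfadjoint_def)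
qed

lemma admissible_F: "admissible P \<Longrightarrow> admissible (F P)"
  by (rule admissible_rhs[OF selfadjoint_U delta_pos admissible_coercive])
    (simp_all add: admissible_def)

text \<open>Without \<open>A11\<close>, what remains of \<open>F\<close> is the form of the inverse
  of \<open>U\<close> evaluated on the range of the adjoint of \<open>A12\<close>; it is
  homogeneous, so the scalar survives.\<close>

lemma F_scaled_antimono:
  assumes P: "admissible P" and P': "admissible P'" and s: "0 \<le> s" and le: "s *\<^sub>R U P \<preceq> U P'"
  shows "s *\<^sub>R (F P' - A11 \<gamma>) \<preceq> F P - A11 \<gamma>"
proof -
  have "s *\<^sub>R op_inverse (U P') \<preceq> op_inverse (U P)"
    using P by (intro op_inverse_antimono[OF selfadjoint_U delta_pos _ _ s le] admissible_coercive P P')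
      (simp add: admissible_def)
  then show ?thesis
    by (simp add: op_le_def blinfun.bilinear_simps inner_diff_left inner_rhs)
qed

lemma F_antimono:
  assumes "admissible P" "admissible P'" "P \<preceq> P'"
  shows "F P' \<preceq> F P"
  using F_scaled_antimono[OF assms(1,2), of 1] U_mono[OF assms(3)]
  by (simp add: op_le_def blinfun.diff_left inner_diff_left)

text \<open>Serves as continuity of \<open>F\<close> at the limit.\<close>

lemma norm_F_diff:
  assumes "admissible P" "admissible P'"
  shows "norm (F P - F P')
    \<le> norm (A12 \<gamma>) * (inverse \<delta> * (norm (P - P') * inverse \<delta>) * norm (cadjoint (A12 \<gamma>)))"
proof -
  let ?D = "op_inverse (U P) - op_inverse (U P')"
  have "F P - F P' = A12 \<gamma> o\<^sub>L (?D o\<^sub>L cadjoint (A12 \<gamma>))"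
    by (rule blinfun_eqI) (simp add: rhs_def blinfun.bilinear_simps)
  also have "norm \<dots> \<le> norm (A12 \<gamma>) * (norm ?D * norm (cadjoint (A12 \<gamma>)))"
    by (intro order_trans[OF norm_blinfun_compose] mult_left_mono norm_blinfun_compose norm_ge_zero)
  also have "norm ?D \<le> inverse \<delta> * (norm (U P - U P') * inverse \<delta>)"
    by (intro norm_op_inverse_diff delta_pos admissible_coercive assms)
  also have "norm (U P - U P') \<le> norm (P - P')"
    using norm_diag_op[of "P - P'"] by (simp add: diag_op_diff)
  finally show ?thesis using delta_pos by (simp add: mult_left_mono mult_right_mono)
qed

section \<open>Alternating monotonicity and the gap between even and odd approximations\<close>

lemma admissible_q_sq: "admissible (q_sq \<gamma> n)"
  by (induction n) (simp_all add: admissible_F, simp add: admissible_def selfadjoint_A11 op_le_refl)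

lemma A11_le_q_sq: "A11 \<gamma> \<preceq> q_sq \<gamma> n"
  using admissible_q_sq by (simp add: admissible_def)

lemma q_sq_antimono_step: "q_sq \<gamma> m \<preceq> q_sq \<gamma> n \<Longrightarrow> q_sq \<gamma> (Suc n) \<preceq> q_sq \<gamma> (Suc m)"
  by (simp add: F_antimono admissible_q_sq)

text \<open>The starting value \<open>A11\<close> lies below every approximation, and two order
  reversals carry each comparison from \<open>n\<close> to \<open>n + 1\<close>.\<close>

lemma q_sq_alternating:
  "q_sq \<gamma> (2 * n) \<preceq> q_sq \<gamma> (Suc (Suc (2 * n)))"
  "q_sq \<gamma> (Suc (Suc (Suc (2 * n)))) \<preceq> q_sq \<gamma> (Suc (2 * n))"
  "q_sq \<gamma> (2 * n) \<preceq> q_sq \<gamma> (Suc (2 * n))"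
proof -
  have "q_sq \<gamma> (2 * n) \<preceq> q_sq \<gamma> (Suc (Suc (2 * n))) \<and> q_sq \<gamma> (2 * n) \<preceq> q_sq \<gamma> (Suc (2 * n))"
  proof (induction n)
    case 0
    then show ?case using A11_le_q_sq[of "Suc 0"] A11_le_q_sq[of "Suc (Suc 0)"] by (simp del: q_sq.simps(2))
  next
    case (Suc n)
    then have "q_sq \<gamma> (Suc (Suc (2 * n))) \<preceq> q_sq \<gamma> (Suc (Suc (Suc (Suc (2 * n)))))"
      "q_sq \<gamma> (Suc (Suc (2 * n))) \<preceq> q_sq \<gamma> (Suc (2 * n))"
      by (blast intro: q_sq_antimono_step)+
    moreover from this(2) have "q_sq \<gamma> (Suc (Suc (2 * n))) \<preceq> q_sq \<gamma> (Suc (Suc (Suc (2 * n))))"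
      by (rule q_sq_antimono_step)
    ultimately show ?case by (simp del: q_sq.simps(2))
  qed
  then show "q_sq \<gamma> (2 * n) \<preceq> q_sq \<gamma> (Suc (Suc (2 * n)))"
    "q_sq \<gamma> (Suc (Suc (Suc (2 * n)))) \<preceq> q_sq \<gamma> (Suc (2 * n))"
    "q_sq \<gamma> (2 * n) \<preceq> q_sq \<gamma> (Suc (2 * n))"
    by (blast intro: q_sq_antimono_step)+
qed

lemma q_sq_even_mono: "m \<le> n \<Longrightarrow> q_sq \<gamma> (2 * m) \<preceq> q_sq \<gamma> (2 * n)"
proof (induction n rule: dec_induct)
  case (step n)
  then show ?case using op_le_trans[OF step.IH q_sq_alternating(1)[of n]] by (simp del: q_sq.simps(2))
qed (rule op_le_refl)

lemma q_sq_odd_antimono: "m \<le> n \<Longrightarrow> q_sq \<gamma> (Suc (2 * n)) \<preceq> q_sq \<gamma> (Suc (2 * m))"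
  by (intro q_sq_antimono_step q_sq_even_mono)

text \<open>
  If \<open>s U\<^sub>2\<^sub>n\<^sub>+\<^sub>1 \<le> U\<^sub>2\<^sub>n\<close>, inverting and applying the iteration turns the first summand of
  \<open>U\<^sub>2\<^sub>n\<^sub>+\<^sub>1 = (U\<^sub>2\<^sub>n\<^sub>+\<^sub>1 - U\<^sub>0) + U\<^sub>0\<close> into at least its multiple by \<open>s\<close>, whereas the second one is
  unchanged and at least \<open>\<beta> U\<^sub>1\<close>. Hence \<open>s\<close> improves to \<open>s + (1 - s) \<beta>\<close>.
\<close>

lemma even_odd_contraction:
  assumes \<beta>: "0 \<le> \<beta>" "\<beta> \<le> 1" "\<beta> *\<^sub>R U (q_sq \<gamma> (Suc 0)) \<preceq> U (A11 \<gamma>)"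
  shows "(1 - (1 - \<beta>) ^ Suc n) *\<^sub>R U (q_sq \<gamma> (Suc (2 * n))) \<preceq> U (q_sq \<gamma> (2 * n))"
proof (induction n)
  case 0
  then show ?case using \<beta>(3) by simp
next
  case (Suc n)
  define s where "s = 1 - (1 - \<beta>) ^ Suc n"
  have s: "0 \<le> s" "s \<le> 1"
    using \<beta> power_le_one[of "1 - \<beta>" "Suc n"] by (simp_all add: s_def del: power_Suc)
  have s': "1 - (1 - \<beta>) ^ Suc (Suc n) = s + (1 - s) * \<beta>"
    by (simp add: s_def algebra_simps)
  have "s *\<^sub>R (q_sq \<gamma> (Suc (2 * n)) - A11 \<gamma>) \<preceq> q_sq \<gamma> (Suc (Suc (2 * n))) - A11 \<gamma>"
    using F_scaled_antimono[OF admissible_q_sq admissible_q_sq s(1) Suc.IH[folded s_def]] by simp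
  \<comment> \<open>\<open>A22\<close> cancels in the differences, so the comparison of
    approximations is one of the operators \<open>U\<close>.\<close>
  from diag_op_mono[OF this]
  have step: "s * (inner (U (q_sq \<gamma> (Suc (2 * n))) x) x - inner (U (A11 \<gamma>) x) x)
      \<le> inner (U (q_sq \<gamma> (Suc (Suc (2 * n)))) x) x - inner (U (A11 \<gamma>) x) x" for x
    by (simp add: op_le_def diag_op_diff diag_op_scaleR blinfun.bilinear_simps inner_diff_left
        del: q_sq.simps)
  have "(s + (1 - s) * \<beta>) * inner (U (q_sq \<gamma> (Suc (Suc (Suc (2 * n))))) x) x
      \<le> inner (U (q_sq \<gamma> (Suc (Suc (2 * n)))) x) x" for x
  proof -
    \<comment> \<open>The chain is \<open>u (2n+2) \<ge> s u (2n+1) + (1 - s) u 0 \<ge> (s + (1 - s)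
      \<beta>) u (2n+3)\<close>; the last step uses that \<open>u\<close> decreases along odd
      indices.\<close>
    define u where "u k = inner (U (q_sq \<gamma> k) x) x" for k
    have "\<beta> * u (Suc 0) \<le> u 0"
      using op_leD[OF \<beta>(3), of x] by (simp add: u_def blinfun.scaleR_left)
    moreover have "\<beta> * u (Suc (Suc (Suc (2 * n)))) \<le> \<beta> * u (Suc 0)"
      unfolding u_def using \<beta>(1) q_sq_odd_antimono[of 0 "Suc n"]
      by (intro mult_left_mono op_leD U_mono) (simp_all del: q_sq.simps)
    ultimately have "(1 - s) * (\<beta> * u (Suc (Suc (Suc (2 * n))))) \<le> (1 - s) * u 0"
      using s by (intro mult_left_mono) auto
    moreover have "s * u (Suc (Suc (Suc (2 * n)))) \<le> s * u (Suc (2 * n))"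
      unfolding u_def using s q_sq_alternating(2)
      by (intro mult_left_mono op_leD U_mono)
    moreover have "s * (u (Suc (2 * n)) - u 0) \<le> u (Suc (Suc (2 * n))) - u 0"
      using step[of x] by (simp add: u_def)
    ultimately have "(s + (1 - s) * \<beta>) * u (Suc (Suc (Suc (2 * n)))) \<le> u (Suc (Suc (2 * n)))"
      by (simp add: algebra_simps)
    then show ?thesis by (simp add: u_def)
  qed
  then show ?case
    by (simp add: op_le_def s' blinfun.scaleR_left del: q_sq.simps power_Suc)
qed

text \<open>For \<open>s = 1 - (1 - \<beta>)^(n+1)\<close>, the contraction bounds
  \<open>U_{2n+1} - U_{2n}\<close> by \<open>(1 - s) U_{2n+1}\<close>, hence by
  \<open>(1 - s) U_1\<close>.\<close>

lemma even_odd_gap: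
  obtains r M where "0 \<le> r" "r < 1" "0 \<le> M"
    "\<And>n. q_sq \<gamma> (Suc (2 * n)) - q_sq \<gamma> (2 * n) \<preceq> (M * r ^ n) *\<^sub>R id_blinfun"
proof -
  \<comment> \<open>\<open>M\<close> bounds \<open>U_1\<close> from above, so
    \<open>\<beta> U_1 \<preceq> \<delta> I \<preceq> U_0\<close> for
    \<open>\<beta> = \<delta> / M\<close>; the extra \<open>\<delta>\<close> ensures
    \<open>\<beta> \<le> 1\<close>.\<close>
  define M where "M = norm (U (q_sq \<gamma> (Suc 0))) + \<delta>"
  define \<beta> where "\<beta> = \<delta> / M"
  have M: "0 < M" "\<delta> \<le> M" using delta_pos by (simp_all add: M_def add_nonneg_pos)
  then have \<beta>: "0 < \<beta>" "\<beta> \<le> 1" using delta_pos by (simp_all add: \<beta>_def)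
  have U1: "inner (U (q_sq \<gamma> (Suc 0)) x) x \<le> M * inner x x" for x
  proof -
    have "inner (U (q_sq \<gamma> (Suc 0)) x) x \<le> norm (U (q_sq \<gamma> (Suc 0))) * inner x x"
      using op_leD[OF op_le_norm[of "U (q_sq \<gamma> (Suc 0))"], of x] by (simp add: blinfun.scaleR_left)
    also have "\<dots> \<le> M * inner x x" using delta_pos by (intro mult_right_mono) (simp_all add: M_def)
    finally show ?thesis .
  qed
  have "\<beta> *\<^sub>R U (q_sq \<gamma> (Suc 0)) \<preceq> U (A11 \<gamma>)"
    unfolding op_le_def
  proof
    fix x
    have "\<beta> * inner (U (q_sq \<gamma> (Suc 0)) x) x \<le> \<beta> * (M * inner x x)"
      using \<beta> U1 by (intro mult_left_mono) auto
    also have "\<dots> \<le> inner (U (A11 \<gamma>) x) x"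
      using op_leD[OF coercive, of x] M by (simp add: \<beta>_def blinfun.scaleR_left)
    finally show "inner ((\<beta> *\<^sub>R U (q_sq \<gamma> (Suc 0))) x) x \<le> inner (U (A11 \<gamma>) x) x"
      by (simp add: blinfun.scaleR_left)
  qed
  note contraction = even_odd_contraction[OF less_imp_le[OF \<beta>(1)] \<beta>(2) this]
  have "q_sq \<gamma> (Suc (2 * n)) - q_sq \<gamma> (2 * n) \<preceq> (M * (1 - \<beta>) ^ n) *\<^sub>R id_blinfun" for n
  proof (rule op_le_if_diag_op_le, unfold op_le_def, rule allI)
    fix x
    define u where "u k = inner (U (q_sq \<gamma> k) x) x" for k
    have "(1 - (1 - \<beta>) ^ Suc n) * u (Suc (2 * n)) \<le> u (2 * n)"
      using op_leD[OF contraction[of n], of x] by (simp add: u_def blinfun.scaleR_left del: q_sq.simps power_Suc)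
    then have "u (Suc (2 * n)) - u (2 * n) \<le> (1 - \<beta>) ^ Suc n * u (Suc (2 * n))"
      by (simp add: algebra_simps del: power_Suc)
    also have "\<dots> \<le> (1 - \<beta>) ^ Suc n * (M * inner x x)"
    proof (rule mult_left_mono)
      have "u (Suc (2 * n)) \<le> u (Suc 0)"
        unfolding u_def using q_sq_odd_antimono[of 0 n] by (intro op_leD U_mono) (simp del: q_sq.simps)
      then show "u (Suc (2 * n)) \<le> M * inner x x" using U1[of x] by (simp add: u_def)
    qed (use \<beta> in simp)
    also have "\<dots> \<le> (1 - \<beta>) ^ n * (M * inner x x)"
      using \<beta> M by (intro mult_right_mono power_decreasing) auto
    finally show "inner (diag_op (q_sq \<gamma> (Suc (2 * n)) - q_sq \<gamma> (2 * n)) x) x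
        \<le> inner (diag_op ((M * (1 - \<beta>) ^ n) *\<^sub>R id_blinfun) x) x"
      by (simp add: u_def diag_op_diff diag_op_scaleR diag_op_id blinfun.bilinear_simps inner_diff_left
          mult.commute mult.left_commute del: q_sq.simps)
  qed
  with that[of "1 - \<beta>" M] \<beta> M show thesis by simp
qed

section \<open>Norm convergence, fixed point and uniqueness\<close>

lemma norm_diff_le_gap:
  assumes "selfadjoint S" "selfadjoint T" "S \<preceq> T" "T \<preceq> S'" "S' - S \<preceq> c *\<^sub>R id_blinfun" "0 \<le> c"
  shows "norm (T - S) \<le> c"
proof (rule norm_le_if_op_le)
  show "T - S \<preceq> c *\<^sub>R id_blinfun"
    unfolding op_le_def
  proof
    fix x
    show "inner ((T - S) x) x \<le> inner ((c *\<^sub>R id_blinfun) x) x"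
      using op_leD[OF assms(4), of x] op_leD[OF assms(5), of x]
      by (simp add: blinfun.diff_left inner_diff_left)
  qed
qed (use assms in \<open>simp_all add: selfadjoint_diff op_le_def blinfun.diff_left inner_diff_left\<close>)

lemma q_sq_limit:
  obtains P where "admissible P" "(\<lambda>n. q_sq \<gamma> (2 * n)) \<longlonglongrightarrow> P"
    "(\<lambda>n. q_sq \<gamma> (Suc (2 * n))) \<longlonglongrightarrow> P" "P = F P"
    "\<And>P'. admissible P' \<Longrightarrow> P' = F P' \<Longrightarrow> P' = P"
proof -
  obtain r M where rM: "0 \<le> r" "r < 1" "0 \<le> M"
    and gap: "\<And>n. q_sq \<gamma> (Suc (2 * n)) - q_sq \<gamma> (2 * n) \<preceq> (M * r ^ n) *\<^sub>R id_blinfun"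
    using even_odd_gap by blast
  have null: "(\<lambda>n. M * r ^ n) \<longlonglongrightarrow> 0"
    using tendsto_mult_right_zero[OF LIMSEQ_power_zero[of r], of M] rM by simp
  have sa: "selfadjoint (q_sq \<gamma> n)" for n
    using admissible_q_sq by (simp add: admissible_def)
  have near: "norm (T - q_sq \<gamma> (2 * n)) \<le> M * r ^ n"
    if "selfadjoint T" "q_sq \<gamma> (2 * n) \<preceq> T" "T \<preceq> q_sq \<gamma> (Suc (2 * n))" for T n
    using norm_diff_le_gap[OF sa that gap] rM by simp
  \<comment> \<open>All later even approximations stay between \<open>q_sq \<gamma> (2 * m)\<close>
    and its successor, so the gap at \<open>m\<close> bounds their distance from the former.\<close>
  have "q_sq \<gamma> (2 * n) \<preceq> q_sq \<gamma> (Suc (2 * m))" if "m \<le> n" for m n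
    by (rule op_le_trans[OF q_sq_alternating(3) q_sq_odd_antimono[OF that]])
  then have close: "norm (q_sq \<gamma> (2 * n) - q_sq \<gamma> (2 * m)) \<le> M * r ^ m" if "m \<le> n" for m n
    using that by (intro near sa q_sq_even_mono)
  have "Cauchy (\<lambda>n. q_sq \<gamma> (2 * n))"
  proof (rule CauchyI')
    fix e :: real assume "0 < e"
    then have "\<forall>\<^sub>F n in sequentially. M * r ^ n < e" by (rule order_tendstoD(2)[OF null])
    then obtain N where N: "\<forall>n\<ge>N. M * r ^ n < e" by (auto simp: eventually_sequentially)
    have "norm (q_sq \<gamma> (2 * m) - q_sq \<gamma> (2 * n)) < e" if "m \<ge> N" "m < n" for m n
    proof -
      have "norm (q_sq \<gamma> (2 * n) - q_sq \<gamma> (2 * m)) \<le> M * r ^ m" using that by (intro close) simp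
      also have "\<dots> < e" using N that by simp
      finally show ?thesis by (simp only: norm_minus_commute)
    qed
    then show "\<exists>N. \<forall>m\<ge>N. \<forall>n>m. dist (q_sq \<gamma> (2 * m)) (q_sq \<gamma> (2 * n)) < e"
      unfolding dist_norm by blast
  qed
  then obtain P where P: "(\<lambda>n. q_sq \<gamma> (2 * n)) \<longlonglongrightarrow> P"
    by (auto simp: Cauchy_convergent_iff convergent_def)
  have adm: "admissible P"
    using selfadjoint_lim[OF P sa] op_le_lim[OF P A11_le_q_sq] by (simp add: admissible_def)
  have "(\<lambda>n. q_sq \<gamma> (Suc (2 * n)) - q_sq \<gamma> (2 * n)) \<longlonglongrightarrow> 0"
    by (rule Lim_null_comparison[OF _ null])
      (intro always_eventually allI near sa q_sq_alternating(3) op_le_refl)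
  from tendsto_add[OF this P] have odd: "(\<lambda>n. q_sq \<gamma> (Suc (2 * n))) \<longlonglongrightarrow> P" by simp
  \<comment> \<open>The odd approximations are \<open>F\<close> of the even ones, so they tend to
    \<open>F P\<close> as well as to \<open>P\<close>.\<close>
  have "(\<lambda>n. q_sq \<gamma> (Suc (2 * n)) - F P) \<longlonglongrightarrow> 0"
  proof (rule Lim_null_comparison)
    show "\<forall>\<^sub>F n in sequentially. norm (q_sq \<gamma> (Suc (2 * n)) - F P) \<le> norm (A12 \<gamma>) *
        (inverse \<delta> * (norm (q_sq \<gamma> (2 * n) - P) * inverse \<delta>) * norm (cadjoint (A12 \<gamma>)))"
      using norm_F_diff[OF admissible_q_sq adm] by simp
    have "(\<lambda>n. norm (q_sq \<gamma> (2 * n) - P)) \<longlonglongrightarrow> 0"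
      using P by (simp add: LIM_zero_iff tendsto_norm_zero)
    from tendsto_mult_left_zero[OF this, of "norm (A12 \<gamma>) * inverse \<delta> * inverse \<delta> * norm (cadjoint (A12 \<gamma>))"]
    show "(\<lambda>n. norm (A12 \<gamma>) *
        (inverse \<delta> * (norm (q_sq \<gamma> (2 * n) - P) * inverse \<delta>) * norm (cadjoint (A12 \<gamma>)))) \<longlonglongrightarrow> 0"
      by (simp add: mult_ac)
  qed
  then have "(\<lambda>n. q_sq \<gamma> (Suc (2 * n))) \<longlonglongrightarrow> F P" by (simp add: LIM_zero_iff)
  then have fix_P: "P = F P" by (rule LIMSEQ_unique[OF odd])
  have "P' = P" if P': "admissible P'" "P' = F P'" for P'
  proof -
    \<comment> \<open>Admissibility puts \<open>P'\<close> above the starting value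
      \<open>A11\<close>; each application of \<open>F\<close> fixes \<open>P'\<close> and reverses
      the inequality.\<close>
    have between: "q_sq \<gamma> (2 * n) \<preceq> P' \<and> P' \<preceq> q_sq \<gamma> (Suc (2 * n))" for n
    proof (induction n)
      case 0
      have "A11 \<gamma> \<preceq> P'" using P'(1) by (simp add: admissible_def)
      moreover from F_antimono[OF admissible_q_sq[of 0] P'(1)] this
      have "P' \<preceq> q_sq \<gamma> (Suc 0)" by (simp flip: P'(2))
      ultimately show ?case by simp
    next
      case (Suc n)
      then have "q_sq \<gamma> (Suc (Suc (2 * n))) \<preceq> P'"
        using F_antimono[OF P'(1) admissible_q_sq[of "Suc (2 * n)"]] by (simp flip: P'(2))
      moreover from F_antimono[OF admissible_q_sq[of "Suc (Suc (2 * n))"] P'(1) this]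
      have "P' \<preceq> q_sq \<gamma> (Suc (Suc (Suc (2 * n))))" by (simp flip: P'(2))
      ultimately show ?case by simp
    qed
    have "norm (P' - q_sq \<gamma> (2 * n)) \<le> M * r ^ n" for n
      using between[of n] P'(1) by (intro near) (simp_all add: admissible_def)
    then have "norm (q_sq \<gamma> (2 * n) - P') \<le> M * r ^ n" for n
      by (simp only: norm_minus_commute)
    then have "(\<lambda>n. q_sq \<gamma> (2 * n) - P') \<longlonglongrightarrow> 0"
      by (intro Lim_null_comparison[OF _ null] always_eventually allI)
    then have "(\<lambda>n. q_sq \<gamma> (2 * n)) \<longlonglongrightarrow> P'" by (simp only: LIM_zero_iff)
    then show ?thesis by (rule LIMSEQ_unique[OF _ P])
  qed
  then show thesis by (rule that[OF adm P odd fix_P])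
qed

text \<open>Strong positivity of \<open>U P\<close> already gives
  \<open>A11 \<gamma> \<preceq> F P\<close>, and \<open>F P = P\<close> for a solution; so every
  solution is admissible and shares the constant \<open>\<delta>\<close>.\<close>

lemma solution_iff: "solution \<gamma> P \<longleftrightarrow> admissible P \<and> P = F P"
proof
  assume sol: "solution \<gamma> P"
  then have "U P \<in> cbounded_ops" "strongly_positive (U P)" and P: "P = F P"
    by (simp_all add: solution_def cbounded_ops_diff diag_op_in_cbounded_ops blocks_in_cbounded_ops)
  then obtain \<epsilon> where "0 < \<epsilon>" "\<epsilon> *\<^sub>R id_blinfun \<preceq> U P" "selfadjoint (U P)"
    using strongly_positive_iff by blast
  then have "admissible (F P)" by (intro admissible_rhs)
  with P show "admissible P \<and> P = F P" by simp
next
  assume P: "admissible P \<and> P = F P"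
  then have sa: "selfadjoint P" by (simp add: admissible_def)
  \<comment> \<open>Adding the nonnegative \<open>A22\<close> to \<open>U P\<close> keeps its lower
    bound, which yields strong positivity of \<open>P\<close>.\<close>
  have "diag_op (\<delta> *\<^sub>R id_blinfun) \<preceq> diag_op P"
    unfolding op_le_def
  proof
    fix x
    have "inner ((\<delta> *\<^sub>R id_blinfun) x) x \<le> inner (U P x) x"
      using P by (intro op_leD admissible_coercive) simp
    moreover have "0 \<le> inner (A22 \<gamma> x) x" using op_leD[OF A22_nonneg, of x] by simp
    ultimately show "inner (diag_op (\<delta> *\<^sub>R id_blinfun) x) x \<le> inner (diag_op P x) x"
      by (simp add: diag_op_scaleR diag_op_id blinfun.diff_left inner_diff_left)
  qed
  then have "strongly_positive P"
    using delta_pos sa op_le_if_diag_op_le selfadjointD(1)[OF sa] by (subst strongly_positive_iff) auto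
  moreover have "strongly_positive (U P)"
    using delta_pos P selfadjoint_U[OF sa] admissible_coercive selfadjointD(1)[OF selfadjoint_U[OF sa]]
    by (subst strongly_positive_iff) auto
  ultimately show "solution \<gamma> P"
    using P selfadjointD(1)[OF sa] by (simp add: solution_def)
qed

end

text \<open>\<open>diag_op\<close> is multiplicative, so the conditions on \<open>\<rho>\<close> are
  those of a solution for its square; existence and uniqueness reduce to square roots.\<close>

lemma minimal_solution_iff:
  fixes \<rho> :: "'a::complex_hilbert \<Rightarrow>\<^sub>L 'a" and \<gamma> :: "nat \<Rightarrow> 'a \<Rightarrow>\<^sub>L 'b::complex_hilbert"
  shows "minimal_solution \<gamma> \<rho> \<longleftrightarrow> \<rho> \<in> cbounded_ops \<and> strongly_positive \<rho> \<and> solution \<gamma> (\<rho> o\<^sub>L \<rho>)"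
  unfolding minimal_solution_def solution_def diag_op_compose
  by (blast intro: cbounded_ops_compose strongly_positive_square)

theorem theorem2p4:
  fixes \<gamma> :: "nat \<Rightarrow> 'a::{complex_hilbert,second_countable_topology}
    \<Rightarrow>\<^sub>L 'b::{complex_hilbert,second_countable_topology}"
  assumes "\<And>k. k \<ge> 1 \<Longrightarrow> \<gamma> k \<in> cbounded_ops"
    and "bounded_blocks (hankel \<gamma>)"
    and "strongly_positive (diag_op (A11 \<gamma>) - A22 \<gamma>)"
    and "positive_op (A11 \<gamma>)"
    and "positive_op (A22 \<gamma>)"
    and "strongly_positive (A12 \<gamma> o\<^sub>L cadjoint (A12 \<gamma>))"
  shows "(\<exists>!P. solution \<gamma> P) \<and> (\<exists>!\<rho>. minimal_solution \<gamma> \<rho>) \<and>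
    (\<forall>P \<rho>. solution \<gamma> P \<longrightarrow> minimal_solution \<gamma> \<rho> \<longrightarrow>
       \<rho> o\<^sub>L \<rho> = P \<and>
       strong_limit (\<lambda>n. q_sq \<gamma> (2 * n)) P \<and>
       strong_limit (\<lambda>n. q_sq \<gamma> (2 * n + 1)) P)"
proof -
  interpret bounded_hankel \<gamma> by unfold_locales (rule assms(1,2), assumption?)+
  note blocks = blocks_in_cbounded_ops
  have U: "diag_op (A11 \<gamma>) - A22 \<gamma> \<in> cbounded_ops"
    by (intro cbounded_ops_diff diag_op_in_cbounded_ops blocks)
  obtain \<delta> where \<delta>: "0 < \<delta>" "\<delta> *\<^sub>R id_blinfun \<preceq> diag_op (A11 \<gamma>) - A22 \<gamma>"
    using assms(3) strongly_positive_iff[OF U] by blast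
  interpret coercive_hankel \<gamma> \<delta>
    using assms(4,5) \<delta> positive_op_iff[OF blocks(1)] positive_op_iff[OF blocks(3)]
    by unfold_locales (auto simp: op_le_def)
  obtain P where adm: "admissible P" "P = F P"
    and lim: "(\<lambda>n. q_sq \<gamma> (2 * n)) \<longlonglongrightarrow> P" "(\<lambda>n. q_sq \<gamma> (Suc (2 * n))) \<longlonglongrightarrow> P"
    and unique: "\<And>P'. admissible P' \<Longrightarrow> P' = F P' \<Longrightarrow> P' = P"
    using q_sq_limit by blast
  have sol: "solution \<gamma> P' \<longleftrightarrow> P' = P" for P'
    using adm unique solution_iff by blast
  have min: "minimal_solution \<gamma> \<rho> \<longleftrightarrow> \<rho> \<in> cbounded_ops \<and> strongly_positive \<rho> \<and> \<rho> o\<^sub>L \<rho> = P" for \<rho>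
    by (simp add: minimal_solution_iff sol)
  have "strongly_positive P" "P \<in> cbounded_ops"
    using sol[of P] by (simp_all add: solution_def)
  then have "\<exists>!\<rho>. minimal_solution \<gamma> \<rho>"
    unfolding min by (rule square_root_unique)
  \<comment> \<open>Norm convergence gives convergence at every vector.\<close>
  moreover have "strong_limit (\<lambda>n. q_sq \<gamma> (2 * n)) P" "strong_limit (\<lambda>n. q_sq \<gamma> (2 * n + 1)) P"
    unfolding strong_limit_def using lim by (auto intro!: blinfun.tendsto tendsto_const simp del: q_sq.simps)
  ultimately show ?thesis by (simp add: sol min)
qed

end
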